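(* Let $\mathscr{D}$ be a Krull--Schmidt triangulated category and $t$ a t-structure on $\mathscr{D}$. Then $\mathscr{D}$ has enough derived projectives with respect to $t$ if and only if $\mathrm{DProj}_t(\mathscr{D})$ is contravariantly finite in $\mathscr{D}^{t\le0}$ and $\mathrm{DProj}_t(\mathscr{D})^{\perp}\cap\heartsuit_t=\{0\}$.
   Context: All categories are linear over a fixed field. A t-structure on $\mathscr{D}$ is written $t=(\mathscr{D}^{t\le0},\mathscr{D}^{t\ge0})$ (cohomological convention: $\mathscr{D}^{t\le0}[1]\subseteq\mathscr{D}^{t\le0}$), with heart $\heartsuit_t=\mathscr{D}^{t\le0}\cap\mathscr{D}^{t\ge0}$ and cohomology functor $H^0_t=t_{\ge0}t_{\le0}\colon\mathscr{D}\to\heartsuit_t$. An object $P$ is derived projective with respect to $t$ if $P\in\mathscr{D}^{t\le0}$ and $\mathrm{Hom}_{\mathscr{D}}(P,X[1])=0$ for all $X\in\mathscr{D}^{t\le0}$; $\mathrm{DProj}_t(\mathscr{D})$ is the full subcategory of derived projective objects. $\mathscr{D}$ has derived projectives (with respect to $t$) if for every projective $P\in\heartsuit_t$ there is $\hat P\in\mathrm{DProj}_t(\mathscr{D})$ with $H^0_t(\hat P)\cong P$; it has enough derived projectives if moreover $\heartsuit_t$ has enough projectives. For a full subcategory $\mathscr{A}$, $\mathscr{A}^\perp=\{X\in\mathscr{D}\mid\mathrm{Hom}(A,X)=0\ \forall A\in\mathscr{A}\}$. A full subcategory $\mathscr{X}\subseteq\mathscr{Y}$ is contravariantly finite in $\mathscr{Y}$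 if every $Y\in\mathscr{Y}$ admits a right $\mathscr{X}$-approximation, i.e. a morphism $X\to Y$ with $X\in\mathscr{X}$ through which every morphism $X'\to Y$ with $X'\in\mathscr{X}$ factors. *)

theory Defs
  imports "HOL-Algebra.Module"
begin

section \<open>Linear categories\<close>

text \<open>
  Each Hom set is a module over the ground field in the sense of HOL-Algebra; its additive structure
  and scalar multiplication are fields of \<open>Hom C X Y\<close>, the inherited multiplicative ones are
  unused.  \<open>Cmp C g f\<close> is the composite ``g after f''.
\<close>

record ('k, 'o, 'm) lin_cat =
  Ob :: "'o set"
  Hom :: "'o \<Rightarrow> 'o \<Rightarrow> ('k, 'm) module"
  Cmp :: "'m \<Rightarrow> 'm \<Rightarrow> 'm"
  Idn :: "'o \<Rightarrow> 'm"

abbreviation mor :: "('k, 'o, 'm, 'z) lin_cat_scheme \<Rightarrow> 'o \<Rightarrow> 'o \<Rightarrow> 'm set"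
  where "mor C X Y \<equiv> carrier (Hom C X Y)"

locale linear_category = field K for K :: "('k, 'e) ring_scheme" (structure) +
  fixes C :: "('k, 'o, 'm, 'z) lin_cat_scheme"
  assumes hom_module: "\<lbrakk>X \<in> Ob C; Y \<in> Ob C\<rbrakk> \<Longrightarrow> module K (Hom C X Y)"
    and hom_disjoint:
      "\<lbrakk>X \<in> Ob C; Y \<in> Ob C; X' \<in> Ob C; Y' \<in> Ob C; f \<in> mor C X Y; f \<in> mor C X' Y'\<rbrakk>
        \<Longrightarrow> X = X' \<and> Y = Y'"
    and idn_closed: "X \<in> Ob C \<Longrightarrow> Idn C X \<in> mor C X X"
    and cmp_closed:
      "\<lbrakk>X \<in> Ob C; Y \<in> Ob C; Z \<in> Ob C; f \<in> mor C X Y; g \<in> mor C Y Z\<rbrakk>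
        \<Longrightarrow> Cmp C g f \<in> mor C X Z"
    and cmp_assoc:
      "\<lbrakk>W \<in> Ob C; X \<in> Ob C; Y \<in> Ob C; Z \<in> Ob C; f \<in> mor C W X; g \<in> mor C X Y; h \<in> mor C Y Z\<rbrakk>
        \<Longrightarrow> Cmp C h (Cmp C g f) = Cmp C (Cmp C h g) f"
    and cmp_idn_left:
      "\<lbrakk>X \<in> Ob C; Y \<in> Ob C; f \<in> mor C X Y\<rbrakk> \<Longrightarrow> Cmp C (Idn C Y) f = f"
    and cmp_idn_right:
      "\<lbrakk>X \<in> Ob C; Y \<in> Ob C; f \<in> mor C X Y\<rbrakk> \<Longrightarrow> Cmp C f (Idn C X) = f"
    and cmp_add_left:
      "\<lbrakk>X \<in> Ob C; Y \<in> Ob C; Z \<in> Ob C; f \<in> mor C X Y; g \<in> mor C Y Z; g' \<in> mor C Y Z\<rbrakk>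
        \<Longrightarrow> Cmp C (g \<oplus>\<^bsub>Hom C Y Z\<^esub> g') f = Cmp C g f \<oplus>\<^bsub>Hom C X Z\<^esub> Cmp C g' f"
    and cmp_add_right:
      "\<lbrakk>X \<in> Ob C; Y \<in> Ob C; Z \<in> Ob C; f \<in> mor C X Y; f' \<in> mor C X Y; g \<in> mor C Y Z\<rbrakk>
        \<Longrightarrow> Cmp C g (f \<oplus>\<^bsub>Hom C X Y\<^esub> f') = Cmp C g f \<oplus>\<^bsub>Hom C X Z\<^esub> Cmp C g f'"
    and cmp_smult_left:
      "\<lbrakk>X \<in> Ob C; Y \<in> Ob C; Z \<in> Ob C; f \<in> mor C X Y; g \<in> mor C Y Z; a \<in> carrier K\<rbrakk>
        \<Longrightarrow> Cmp C (a \<odot>\<^bsub>Hom C Y Z\<^esub> g) f = a \<odot>\<^bsub>Hom C X Z\<^esub> Cmp C g f"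
    and cmp_smult_right:
      "\<lbrakk>X \<in> Ob C; Y \<in> Ob C; Z \<in> Ob C; f \<in> mor C X Y; g \<in> mor C Y Z; a \<in> carrier K\<rbrakk>
        \<Longrightarrow> Cmp C g (a \<odot>\<^bsub>Hom C X Y\<^esub> f) = a \<odot>\<^bsub>Hom C X Z\<^esub> Cmp C g f"

definition hom_zero :: "('k, 'o, 'm, 'z) lin_cat_scheme \<Rightarrow> 'o \<Rightarrow> 'o \<Rightarrow> bool"
  where "hom_zero C X Y \<longleftrightarrow> mor C X Y = {\<zero>\<^bsub>Hom C X Y\<^esub>}"

definition is_iso :: "('k, 'o, 'm, 'z) lin_cat_scheme \<Rightarrow> 'o \<Rightarrow> 'o \<Rightarrow> 'm \<Rightarrow> bool"
  where "is_iso C X Y f \<longleftrightarrow> f \<in> mor C X Y \<and>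
    (\<exists>g \<in> mor C Y X. Cmp C g f = Idn C X \<and> Cmp C f g = Idn C Y)"

definition isomorphic :: "('k, 'o, 'm, 'z) lin_cat_scheme \<Rightarrow> 'o \<Rightarrow> 'o \<Rightarrow> bool"
  where "isomorphic C X Y \<longleftrightarrow> (\<exists>f. is_iso C X Y f)"

definition zero_object :: "('k, 'o, 'm, 'z) lin_cat_scheme \<Rightarrow> 'o \<Rightarrow> bool"
  where "zero_object C Z \<longleftrightarrow> Z \<in> Ob C \<and> (\<forall>X \<in> Ob C. hom_zero C Z X \<and> hom_zero C X Z)"

text \<open>
  \<open>X\<close> is a direct sum (biproduct) of \<open>Y 0, \<dots>, Y (n - 1)\<close>; for \<open>n = 0\<close> this says that the identity
  of \<open>X\<close> is zero, i.e. that \<open>X\<close> is a zero object.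
\<close>

definition is_direct_sum :: "('k, 'o, 'm, 'z) lin_cat_scheme \<Rightarrow> 'o \<Rightarrow> nat \<Rightarrow> (nat \<Rightarrow> 'o) \<Rightarrow> bool"
  where "is_direct_sum C X n Y \<longleftrightarrow> (\<exists>\<iota> \<pi>.
    (\<forall>i<n. \<iota> i \<in> mor C (Y i) X \<and> \<pi> i \<in> mor C X (Y i)) \<and>
    (\<forall>i<n. \<forall>j<n. Cmp C (\<pi> i) (\<iota> j) = (if i = j then Idn C (Y i) else \<zero>\<^bsub>Hom C (Y j) (Y i)\<^esub>)) \<and>
    finsum (Hom C X X) (\<lambda>i. Cmp C (\<iota> i) (\<pi> i)) {..<n} = Idn C X)"

locale additive_category = linear_category K C
  for K :: "('k, 'e) ring_scheme" (structure) and C :: "('k, 'o, 'm, 'z) lin_cat_scheme" +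
  assumes direct_sums: "(\<forall>i<n. Y i \<in> Ob C) \<Longrightarrow> \<exists>X \<in> Ob C. is_direct_sum C X n Y"


section \<open>Krull--Schmidt categories\<close>

definition End_ring :: "('k, 'o, 'm, 'z) lin_cat_scheme \<Rightarrow> 'o \<Rightarrow> 'm ring"
  where "End_ring C X = \<lparr>carrier = mor C X X, mult = Cmp C, one = Idn C X,
    zero = \<zero>\<^bsub>Hom C X X\<^esub>, add = add (Hom C X X)\<rparr>"

definition local_ring :: "('r, 'e) ring_scheme \<Rightarrow> bool"
  where "local_ring R \<longleftrightarrow> ring R \<and> \<one>\<^bsub>R\<^esub> \<noteq> \<zero>\<^bsub>R\<^esub> \<and>
    (\<forall>a \<in> carrier R - Units R. \<forall>b \<in> carrier R - Units R. a \<oplus>\<^bsub>R\<^esub> b \<notin> Units R)"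

definition krull_schmidt :: "('k, 'o, 'm, 'z) lin_cat_scheme \<Rightarrow> bool"
  where "krull_schmidt C \<longleftrightarrow> (\<forall>X \<in> Ob C. \<exists>n Y.
    (\<forall>i<n. Y i \<in> Ob C \<and> local_ring (End_ring C (Y i))) \<and> is_direct_sum C X n Y)"


section \<open>Autoequivalences\<close>

definition linear_endofunctor ::
    "('k, 'e) ring_scheme \<Rightarrow> ('k, 'o, 'm, 'z) lin_cat_scheme \<Rightarrow> ('o \<Rightarrow> 'o) \<Rightarrow> ('m \<Rightarrow> 'm) \<Rightarrow> bool"
  where "linear_endofunctor K C F F' \<longleftrightarrow>
    (\<forall>X \<in> Ob C. F X \<in> Ob C \<and> F' (Idn C X) = Idn C (F X)) \<and>
    (\<forall>X \<in> Ob C. \<forall>Y \<in> Ob C. \<forall>f \<in> mor C X Y.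
      F' f \<in> mor C (F X) (F Y) \<and>
      (\<forall>g \<in> mor C X Y. F' (f \<oplus>\<^bsub>Hom C X Y\<^esub> g) = F' f \<oplus>\<^bsub>Hom C (F X) (F Y)\<^esub> F' g) \<and>
      (\<forall>a \<in> carrier K. F' (a \<odot>\<^bsub>Hom C X Y\<^esub> f) = a \<odot>\<^bsub>Hom C (F X) (F Y)\<^esub> F' f)) \<and>
    (\<forall>X \<in> Ob C. \<forall>Y \<in> Ob C. \<forall>Z \<in> Ob C. \<forall>f \<in> mor C X Y. \<forall>g \<in> mor C Y Z.
      F' (Cmp C g f) = Cmp C (F' g) (F' f))"

definition natural_iso ::
    "('k, 'o, 'm, 'z) lin_cat_scheme \<Rightarrow> ('o \<Rightarrow> 'o) \<Rightarrow> ('m \<Rightarrow> 'm) \<Rightarrow> ('o \<Rightarrow> 'o) \<Rightarrow> ('m \<Rightarrow> 'm)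
      \<Rightarrow> ('o \<Rightarrow> 'm) \<Rightarrow> bool"
  where "natural_iso C F F' G G' \<alpha> \<longleftrightarrow>
    (\<forall>X \<in> Ob C. is_iso C (F X) (G X) (\<alpha> X)) \<and>
    (\<forall>X \<in> Ob C. \<forall>Y \<in> Ob C. \<forall>f \<in> mor C X Y. Cmp C (\<alpha> Y) (F' f) = Cmp C (G' f) (\<alpha> X))"

definition linear_autoequivalence ::
    "('k, 'e) ring_scheme \<Rightarrow> ('k, 'o, 'm, 'z) lin_cat_scheme \<Rightarrow> ('o \<Rightarrow> 'o) \<Rightarrow> ('m \<Rightarrow> 'm) \<Rightarrow> bool"
  where "linear_autoequivalence K C F F' \<longleftrightarrow> linear_endofunctor K C F F' \<and>
    (\<exists>G G' \<eta> \<epsilon>. linear_endofunctor K C G G' \<and>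
      natural_iso C (\<lambda>X. X) (\<lambda>f. f) (G \<circ> F) (G' \<circ> F') \<eta> \<and>
      natural_iso C (F \<circ> G) (F' \<circ> G') (\<lambda>X. X) (\<lambda>f. f) \<epsilon>)"


section \<open>Triangulated categories\<close>

text \<open>
  \<open>Sh D X\<close> is \<open>X[1]\<close>, \<open>Shm D f\<close> is \<open>f[1]\<close>, and \<open>Dist D X Y Z f g h\<close> says that
  \<open>X \<rightarrow> Y \<rightarrow> Z \<rightarrow> X[1]\<close> with maps \<open>f\<close>, \<open>g\<close>, \<open>h\<close> is a distinguished triangle.
\<close>

record ('k, 'o, 'm) tri_cat = "('k, 'o, 'm) lin_cat" +
  Sh :: "'o \<Rightarrow> 'o"
  Shm :: "'m \<Rightarrow> 'm"
  Dist :: "'o \<Rightarrow> 'o \<Rightarrow> 'o \<Rightarrow> 'm \<Rightarrow> 'm \<Rightarrow> 'm \<Rightarrow> bool"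

definition is_triangle ::
    "('k, 'o, 'm, 'z) tri_cat_scheme \<Rightarrow> 'o \<Rightarrow> 'o \<Rightarrow> 'o \<Rightarrow> 'm \<Rightarrow> 'm \<Rightarrow> 'm \<Rightarrow> bool"
  where "is_triangle D X Y Z f g h \<longleftrightarrow> X \<in> Ob D \<and> Y \<in> Ob D \<and> Z \<in> Ob D \<and>
    f \<in> mor D X Y \<and> g \<in> mor D Y Z \<and> h \<in> mor D Z (Sh D X)"

text \<open>
  The shift is only required to be an autoequivalence, so rotation is stated as an equivalence
  instead of by means of a strict inverse shift.
\<close>

locale triangulated_category = additive_category K D
  for K :: "('k, 'e) ring_scheme" (structure) and D :: "('k, 'o, 'm, 'z) tri_cat_scheme" +
  assumes shift_autoequivalence: "linear_autoequivalence K D (Sh D) (Shm D)"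
    and dist_triangle: "Dist D X Y Z f g h \<Longrightarrow> is_triangle D X Y Z f g h"
    and TR1_iso:
      "\<lbrakk>Dist D X Y Z f g h; is_triangle D X' Y' Z' f' g' h';
        is_iso D X X' a; is_iso D Y Y' b; is_iso D Z Z' c;
        Cmp D b f = Cmp D f' a; Cmp D c g = Cmp D g' b; Cmp D (Shm D a) h = Cmp D h' c\<rbrakk>
        \<Longrightarrow> Dist D X' Y' Z' f' g' h'"
    and TR1_idn:
      "\<lbrakk>X \<in> Ob D; zero_object D Z\<rbrakk>
        \<Longrightarrow> Dist D X X Z (Idn D X) \<zero>\<^bsub>Hom D X Z\<^esub> \<zero>\<^bsub>Hom D Z (Sh D X)\<^esub>"
    and TR1_cone:
      "\<lbrakk>X \<in> Ob D; Y \<in> Ob D; f \<in> mor D X Y\<rbrakk> \<Longrightarrow> \<exists>Z g h. Dist D X Y Z f g h"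
    and TR2_rotate:
      "is_triangle D X Y Z f g h \<Longrightarrow>
        Dist D X Y Z f g h \<longleftrightarrow>
        Dist D Y Z (Sh D X) g h (\<ominus>\<^bsub>Hom D (Sh D X) (Sh D Y)\<^esub> Shm D f)"
    and TR3:
      "\<lbrakk>Dist D X Y Z f g h; Dist D X' Y' Z' f' g' h'; a \<in> mor D X X'; b \<in> mor D Y Y';
        Cmp D b f = Cmp D f' a\<rbrakk>
        \<Longrightarrow> \<exists>c \<in> mor D Z Z'. Cmp D c g = Cmp D g' b \<and> Cmp D (Shm D a) h = Cmp D h' c"
    and TR4_octahedral:
      "\<lbrakk>Dist D X Y Z' f a b; Dist D Y Z X' g c d; Dist D X Z Y' (Cmp D g f) e h\<rbrakk>
        \<Longrightarrow> \<exists>u \<in> mor D Z' Y'. \<exists>v \<in> mor D Y' X'.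
          Cmp D u a = Cmp D e g \<and> Cmp D h u = b \<and>
          Cmp D v e = c \<and> Cmp D d v = Cmp D (Shm D f) h \<and>
          Dist D Z' Y' X' u v (Cmp D (Shm D a) d)"


section \<open>Full subcategories\<close>

text \<open>Full subcategories are given by their sets of objects.\<close>

definition iso_closed :: "('k, 'o, 'm, 'z) lin_cat_scheme \<Rightarrow> 'o set \<Rightarrow> bool"
  where "iso_closed C S \<longleftrightarrow> (\<forall>X \<in> S. \<forall>Y \<in> Ob C. isomorphic C X Y \<longrightarrow> Y \<in> S)"

definition epi_in :: "('k, 'o, 'm, 'z) lin_cat_scheme \<Rightarrow> 'o set \<Rightarrow> 'o \<Rightarrow> 'o \<Rightarrow> 'm \<Rightarrow> bool"
  where "epi_in C S X Y f \<longleftrightarrow> X \<in> S \<and> Y \<in> S \<and> f \<in> mor C X Y \<and>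
    (\<forall>Z \<in> S. \<forall>g \<in> mor C Y Z. \<forall>h \<in> mor C Y Z. Cmp C g f = Cmp C h f \<longrightarrow> g = h)"

definition projective_in :: "('k, 'o, 'm, 'z) lin_cat_scheme \<Rightarrow> 'o set \<Rightarrow> 'o \<Rightarrow> bool"
  where "projective_in C S P \<longleftrightarrow> P \<in> S \<and>
    (\<forall>X Y e. epi_in C S X Y e \<longrightarrow> (\<forall>f \<in> mor C P Y. \<exists>g \<in> mor C P X. Cmp C e g = f))"

definition enough_projectives_in :: "('k, 'o, 'm, 'z) lin_cat_scheme \<Rightarrow> 'o set \<Rightarrow> bool"
  where "enough_projectives_in C S \<longleftrightarrow>
    (\<forall>X \<in> S. \<exists>P e. projective_in C S P \<and> epi_in C S P X e)"

definition right_perp :: "('k, 'o, 'm, 'z) lin_cat_scheme \<Rightarrow> 'o set \<Rightarrow> 'o set"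
  where "right_perp C A = {X \<in> Ob C. \<forall>Y \<in> A. hom_zero C Y X}"

definition right_approximation ::
    "('k, 'o, 'm, 'z) lin_cat_scheme \<Rightarrow> 'o set \<Rightarrow> 'o \<Rightarrow> 'o \<Rightarrow> 'm \<Rightarrow> bool"
  where "right_approximation C A X Y f \<longleftrightarrow> X \<in> A \<and> f \<in> mor C X Y \<and>
    (\<forall>X' \<in> A. \<forall>f' \<in> mor C X' Y. \<exists>g \<in> mor C X' X. Cmp C f g = f')"

definition contravariantly_finite ::
    "('k, 'o, 'm, 'z) lin_cat_scheme \<Rightarrow> 'o set \<Rightarrow> 'o set \<Rightarrow> bool"
  where "contravariantly_finite C A B \<longleftrightarrow> A \<subseteq> B \<and>
    (\<forall>Y \<in> B. \<exists>X f. right_approximation C A X Y f)"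


section \<open>t-structures\<close>

record 'o t_str =
  Le0 :: "'o set"
  Ge0 :: "'o set"

text \<open>
  For a replete subcategory, \<open>Y\<close> lies in \<open>Ge0[-1]\<close> if and only if \<open>Y[1]\<close> lies in \<open>Ge0\<close>.
\<close>

definition Ge1 :: "('k, 'o, 'm, 'z) tri_cat_scheme \<Rightarrow> 'o t_str \<Rightarrow> 'o set"
  where "Ge1 D t = {Y \<in> Ob D. Sh D Y \<in> Ge0 t}"

definition Le_minus1 :: "('k, 'o, 'm, 'z) tri_cat_scheme \<Rightarrow> 'o t_str \<Rightarrow> 'o set"
  where "Le_minus1 D t = {Y \<in> Ob D. \<exists>X \<in> Le0 t. isomorphic D (Sh D X) Y}"

definition t_structure :: "('k, 'o, 'm, 'z) tri_cat_scheme \<Rightarrow> 'o t_str \<Rightarrow> bool"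
  where "t_structure D t \<longleftrightarrow>
    Le0 t \<subseteq> Ob D \<and> Ge0 t \<subseteq> Ob D \<and> iso_closed D (Le0 t) \<and> iso_closed D (Ge0 t) \<and>
    (\<forall>X \<in> Le0 t. Sh D X \<in> Le0 t) \<and> Ge1 D t \<subseteq> Ge0 t \<and>
    (\<forall>X \<in> Le0 t. \<forall>Y \<in> Ge1 D t. hom_zero D X Y) \<and>
    (\<forall>X \<in> Ob D. \<exists>A \<in> Le0 t. \<exists>B \<in> Ge1 D t. \<exists>f g h. Dist D A X B f g h)"

definition heart :: "'o t_str \<Rightarrow> 'o set"
  where "heart t = Le0 t \<inter> Ge0 t"

text \<open>
  The truncation functors and \<open>H\<^sup>0\<close> on objects: the outer terms of the truncation triangles are
  unique up to isomorphism, and \<open>SOME\<close> fixes a representative.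
\<close>

definition tau_le0 :: "('k, 'o, 'm, 'z) tri_cat_scheme \<Rightarrow> 'o t_str \<Rightarrow> 'o \<Rightarrow> 'o"
  where "tau_le0 D t X = (SOME A. A \<in> Le0 t \<and> (\<exists>B \<in> Ge1 D t. \<exists>f g h. Dist D A X B f g h))"

definition tau_ge0 :: "('k, 'o, 'm, 'z) tri_cat_scheme \<Rightarrow> 'o t_str \<Rightarrow> 'o \<Rightarrow> 'o"
  where "tau_ge0 D t X = (SOME B. B \<in> Ge0 t \<and> (\<exists>A \<in> Le_minus1 D t. \<exists>f g h. Dist D A X B f g h))"

definition H0 :: "('k, 'o, 'm, 'z) tri_cat_scheme \<Rightarrow> 'o t_str \<Rightarrow> 'o \<Rightarrow> 'o"
  where "H0 D t X = tau_ge0 D t (tau_le0 D t X)"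


section \<open>Derived projectives\<close>

definition DProj :: "('k, 'o, 'm, 'z) tri_cat_scheme \<Rightarrow> 'o t_str \<Rightarrow> 'o set"
  where "DProj D t = {P \<in> Le0 t. \<forall>X \<in> Le0 t. hom_zero D P (Sh D X)}"

definition has_derived_projectives :: "('k, 'o, 'm, 'z) tri_cat_scheme \<Rightarrow> 'o t_str \<Rightarrow> bool"
  where "has_derived_projectives D t \<longleftrightarrow>
    (\<forall>P. projective_in D (heart t) P \<longrightarrow> (\<exists>Q \<in> DProj D t. isomorphic D (H0 D t Q) P))"

definition has_enough_derived_projectives :: "('k, 'o, 'm, 'z) tri_cat_scheme \<Rightarrow> 'o t_str \<Rightarrow> bool"
  where "has_enough_derived_projectives D t \<longleftrightarrow>
    has_derived_projectives D t \<and> enough_projectives_in D (heart t)"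

end

theory Submission
  imports Defs
begin

text \<open>
  For \<open>Y\<close> in \<open>Le0 t\<close>, the truncation \<open>Y \<rightarrow> H\<^sup>0 Y\<close> is the reflection of \<open>Y\<close> into the heart, and a map in \<open>Le0 t\<close>
  induces an epimorphism on \<open>H\<^sup>0\<close> if and only if its cone lies in \<open>Le_minus1 D t\<close>.  Derived projectives
  have no nonzero maps into \<open>Le_minus1 D t\<close>; so a map from a derived projective whose cone lies
  there is a right approximation, and \<open>H\<^sup>0\<close> of a derived projective is projective.

  Given enough derived projectives, lift an epimorphism from a projective onto \<open>H\<^sup>0 Y\<close> to a map from a
  derived projective to \<open>Y\<close>.  Conversely, the cone of an approximation of \<open>Y\<close> has its \<open>H\<^sup>0\<close> in the
  orthogonal, hence lies in \<open>Le_minus1 D t\<close>.  Thus a projective \<open>P\<close> of the heart is a retract of \<open>H\<^sup>0 Q\<close>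
  with \<open>Q\<close> derived projective.  Decompose \<open>Q\<close> into objects \<open>Q i\<close> with local endomorphism rings.  As
  endomorphisms of \<open>H\<^sup>0 (Q i)\<close> lift to \<open>Q i\<close>, an exchange argument makes \<open>P\<close> a direct sum of some of the
  \<open>H\<^sup>0 (Q i)\<close>, that is, \<open>H\<^sup>0\<close> of the direct sum of the corresponding \<open>Q i\<close>.
\<close>

section \<open>Linear categories\<close>

context linear_category
begin

section \<open>Composition and the additive structure of Hom sets\<close>

abbreviation comp (infixr "\<cdot>" 70)
  where "g \<cdot> f \<equiv> Cmp C g f"

abbreviation zr :: "'o \<Rightarrow> 'o \<Rightarrow> 'm"
  where "zr X Y \<equiv> \<zero>\<^bsub>Hom C X Y\<^esub>"

abbreviation sub :: "'o \<Rightarrow> 'o \<Rightarrow> 'm \<Rightarrow> 'm \<Rightarrow> 'm"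
  where "sub X Y f g \<equiv> f \<ominus>\<^bsub>Hom C X Y\<^esub> g"

text \<open>The axioms constrain Hom sets between objects only, so a typing has to carry membership
  of both ends. With this packaged, rules can be instantiated by typings of arrows alone.\<close>

definition arr :: "'o \<Rightarrow> 'o \<Rightarrow> 'm \<Rightarrow> bool"
  where "arr X Y f \<longleftrightarrow> X \<in> Ob C \<and> Y \<in> Ob C \<and> f \<in> mor C X Y"

lemma arrI: "X \<in> Ob C \<Longrightarrow> Y \<in> Ob C \<Longrightarrow> f \<in> mor C X Y \<Longrightarrow> arr X Y f"
  by (simp add: arr_def)

lemma arrD:
  assumes "arr X Y f"
  shows "X \<in> Ob C" "Y \<in> Ob C" "f \<in> mor C X Y"
  using assms by (simp_all add: arr_def)

lemma hom_abelian_group: "X \<in> Ob C \<Longrightarrow> Y \<in> Ob C \<Longrightarrow> abelian_group (Hom C X Y)"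
  using hom_module module_def by blast

lemma arr_idn: "X \<in> Ob C \<Longrightarrow> arr X X (Idn C X)"
  by (simp add: arrI idn_closed)

lemma arr_cmp: "arr X Y f \<Longrightarrow> arr Y Z g \<Longrightarrow> arr X Z (g \<cdot> f)"
  using cmp_closed unfolding arr_def by blast

lemma arr_zero: "X \<in> Ob C \<Longrightarrow> Y \<in> Ob C \<Longrightarrow> arr X Y (zr X Y)"
  using hom_abelian_group[of X Y] by (simp add: arr_def abelian_group_def abelian_monoid.zero_closed)

lemma arr_add: "arr X Y f \<Longrightarrow> arr X Y g \<Longrightarrow> arr X Y (f \<oplus>\<^bsub>Hom C X Y\<^esub> g)"
  using hom_abelian_group[of X Y] by (simp add: arr_def abelian_group_def abelian_monoid.a_closed)

lemma arr_sub: "arr X Y f \<Longrightarrow> arr X Y g \<Longrightarrow> arr X Y (sub X Y f g)"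
  using hom_abelian_group[of X Y] by (simp add: arr_def abelian_group.minus_closed)

lemma arr_uminus: "arr X Y f \<Longrightarrow> arr X Y (\<ominus>\<^bsub>Hom C X Y\<^esub> f)"
  using hom_abelian_group[of X Y] by (simp add: arr_def abelian_group.a_inv_closed)

lemma assoc: "arr W X f \<Longrightarrow> arr X Y g \<Longrightarrow> arr Y Z h \<Longrightarrow> h \<cdot> g \<cdot> f = (h \<cdot> g) \<cdot> f"
  using cmp_assoc unfolding arr_def by blast

lemma idn_left: "arr X Y f \<Longrightarrow> Idn C Y \<cdot> f = f"
  using cmp_idn_left unfolding arr_def by blast

lemma idn_right: "arr X Y f \<Longrightarrow> f \<cdot> Idn C X = f"
  using cmp_idn_right unfolding arr_def by blast

lemma add_left:
  "arr X Y f \<Longrightarrow> arr Y Z g \<Longrightarrow> arr Y Z g' \<Longrightarrow>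
    (g \<oplus>\<^bsub>Hom C Y Z\<^esub> g') \<cdot> f = g \<cdot> f \<oplus>\<^bsub>Hom C X Z\<^esub> g' \<cdot> f"
  using cmp_add_left unfolding arr_def by blast

lemma add_right:
  "arr X Y f \<Longrightarrow> arr X Y f' \<Longrightarrow> arr Y Z g \<Longrightarrow>
    g \<cdot> (f \<oplus>\<^bsub>Hom C X Y\<^esub> f') = g \<cdot> f \<oplus>\<^bsub>Hom C X Z\<^esub> g \<cdot> f'"
  using cmp_add_right unfolding arr_def by blast

lemma sub_eqI:
  assumes "arr X Y f" "arr X Y g" "arr X Y h" "h \<oplus>\<^bsub>Hom C X Y\<^esub> g = f"
  shows "sub X Y f g = h"
proof -
  interpret abelian_group "Hom C X Y" using assms arrD hom_abelian_group by blast
  show ?thesis using assms unfolding arr_def a_minus_def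
    by (auto simp: a_assoc r_neg)
qed

lemma sub_add:
  assumes "arr X Y f" "arr X Y g"
  shows "sub X Y f g \<oplus>\<^bsub>Hom C X Y\<^esub> g = f"
proof -
  interpret abelian_group "Hom C X Y" using assms arrD hom_abelian_group by blast
  show ?thesis using assms unfolding arr_def a_minus_def
    by (auto simp: a_assoc l_neg)
qed

lemma add_zero_right: "arr X Y f \<Longrightarrow> f \<oplus>\<^bsub>Hom C X Y\<^esub> zr X Y = f"
  using hom_abelian_group[of X Y] by (simp add: arr_def abelian_group_def abelian_monoid.r_zero)

lemma add_zero_left: "arr X Y f \<Longrightarrow> zr X Y \<oplus>\<^bsub>Hom C X Y\<^esub> f = f"
  using hom_abelian_group[of X Y] by (simp add: arr_def abelian_group_def abelian_monoid.l_zero)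

lemma sub_self: "arr X Y f \<Longrightarrow> sub X Y f f = zr X Y"
  using arr_zero add_zero_left arrD by (intro sub_eqI) auto

lemma sub_zero: "arr X Y f \<Longrightarrow> sub X Y f (zr X Y) = f"
  using arr_zero add_zero_right arrD by (intro sub_eqI) auto

lemma sub_eq_zeroD: "arr X Y f \<Longrightarrow> arr X Y g \<Longrightarrow> sub X Y f g = zr X Y \<Longrightarrow> f = g"
  using sub_add add_zero_left by metis

lemma cancel_add:
  assumes "arr X Y f" "arr X Y g" "f \<oplus>\<^bsub>Hom C X Y\<^esub> g = g"
  shows "f = zr X Y"
  using sub_eqI[of X Y g g f] sub_self assms by metis

lemma zero_left: "arr X Y f \<Longrightarrow> Z \<in> Ob C \<Longrightarrow> zr Y Z \<cdot> f = zr X Z"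
  using add_left[of X Y f Z "zr Y Z" "zr Y Z"] arr_zero[of Y Z] add_zero_left[of Y Z "zr Y Z"]
    cancel_add[of X Z "zr Y Z \<cdot> f" "zr Y Z \<cdot> f"] arr_cmp arrD by metis

lemma zero_right: "arr Y Z g \<Longrightarrow> X \<in> Ob C \<Longrightarrow> g \<cdot> zr X Y = zr X Z"
  using add_right[of X Y "zr X Y" "zr X Y" Z g] arr_zero[of X Y] add_zero_left[of X Y "zr X Y"]
    cancel_add[of X Z "g \<cdot> zr X Y" "g \<cdot> zr X Y"] arr_cmp arrD by metis

lemma sub_left:
  assumes "arr X Y f" "arr Y Z g" "arr Y Z g'"
  shows "sub Y Z g g' \<cdot> f = sub X Z (g \<cdot> f) (g' \<cdot> f)"
  using sub_eqI[of X Z "g \<cdot> f" "g' \<cdot> f" "sub Y Z g g' \<cdot> f"] add_left[of X Y f Z "sub Y Z g g'" g']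
    sub_add[of Y Z g g'] arr_sub[of Y Z g g'] arr_cmp assms by metis

lemma sub_right:
  assumes "arr X Y f" "arr X Y f'" "arr Y Z g"
  shows "g \<cdot> sub X Y f f' = sub X Z (g \<cdot> f) (g \<cdot> f')"
  using sub_eqI[of X Z "g \<cdot> f" "g \<cdot> f'" "g \<cdot> sub X Y f f'"] add_right[of X Y "sub X Y f f'" f' Z g]
    sub_add[of X Y f f'] arr_sub[of X Y f f'] arr_cmp assms by metis

lemma uminus_left:
  assumes "arr X Y f" "arr Y Z g"
  shows "(\<ominus>\<^bsub>Hom C Y Z\<^esub> g) \<cdot> f = \<ominus>\<^bsub>Hom C X Z\<^esub> (g \<cdot> f)"
proof -
  interpret a: abelian_group "Hom C X Z" using assms arrD hom_abelian_group by blast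
  interpret b: abelian_group "Hom C Y Z" using assms arrD hom_abelian_group by blast
  have "(\<ominus>\<^bsub>Hom C Y Z\<^esub> g) \<cdot> f \<oplus>\<^bsub>Hom C X Z\<^esub> g \<cdot> f = zr X Z"
    using add_left[OF assms(1) arr_uminus[OF assms(2)] assms(2)] b.l_neg[of g] zero_left[OF assms(1)]
      arrD[OF assms(2)] by simp
  then show ?thesis
    using a.minus_equality arrD(3) arr_cmp[OF assms] arr_cmp[OF assms(1) arr_uminus[OF assms(2)]] by metis
qed

lemma uminus_right:
  assumes "arr X Y f" "arr Y Z g"
  shows "g \<cdot> (\<ominus>\<^bsub>Hom C X Y\<^esub> f) = \<ominus>\<^bsub>Hom C X Z\<^esub> (g \<cdot> f)"
proof -
  interpret a: abelian_group "Hom C X Z" using assms arrD hom_abelian_group by blast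
  interpret b: abelian_group "Hom C X Y" using assms arrD hom_abelian_group by blast
  have "g \<cdot> (\<ominus>\<^bsub>Hom C X Y\<^esub> f) \<oplus>\<^bsub>Hom C X Z\<^esub> g \<cdot> f = zr X Z"
    using add_right[OF arr_uminus[OF assms(1)] assms(1) assms(2)] b.l_neg[of f] zero_right[OF assms(2)]
      arrD[OF assms(1)] by simp
  then show ?thesis
    using a.minus_equality arrD(3) arr_cmp[OF assms] arr_cmp[OF arr_uminus[OF assms(1)] assms(2)] by metis
qed

lemma uminus_inject:
  assumes "arr X Y f" "arr X Y g" "\<ominus>\<^bsub>Hom C X Y\<^esub> f = \<ominus>\<^bsub>Hom C X Y\<^esub> g"
  shows "f = g"
proof -
  interpret abelian_group "Hom C X Y" using assms arrD hom_abelian_group by blast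
  show ?thesis using assms arrD(3) minus_minus by metis
qed

lemma uminus_zero:
  assumes "X \<in> Ob C" "Y \<in> Ob C"
  shows "\<ominus>\<^bsub>Hom C X Y\<^esub> zr X Y = zr X Y"
proof -
  interpret abelian_group "Hom C X Y" using assms hom_abelian_group by blast
  show ?thesis by (simp add: minus_equality)
qed

section \<open>Vanishing Hom sets, isomorphisms and zero objects\<close>

lemma hom_zeroD: "hom_zero C X Y \<Longrightarrow> arr X Y f \<Longrightarrow> f = zr X Y"
  by (auto simp: hom_zero_def arr_def)

lemma hom_zeroI:
  "X \<in> Ob C \<Longrightarrow> Y \<in> Ob C \<Longrightarrow> (\<And>f. arr X Y f \<Longrightarrow> f = zr X Y) \<Longrightarrow> hom_zero C X Y"
  using arr_zero[of X Y] unfolding hom_zero_def arr_def by blast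

lemma is_isoE:
  assumes "is_iso C X Y f" "X \<in> Ob C" "Y \<in> Ob C"
  obtains g where "arr X Y f" "arr Y X g" "g \<cdot> f = Idn C X" "f \<cdot> g = Idn C Y"
  using assms by (auto simp: is_iso_def arr_def)

lemma is_isoI: "arr X Y f \<Longrightarrow> arr Y X g \<Longrightarrow> g \<cdot> f = Idn C X \<Longrightarrow> f \<cdot> g = Idn C Y \<Longrightarrow> is_iso C X Y f"
  by (auto simp: is_iso_def arr_def)

lemma is_iso_idn: "X \<in> Ob C \<Longrightarrow> is_iso C X X (Idn C X)"
  using is_isoI[of X X "Idn C X" "Idn C X"] arr_idn idn_left by blast

lemma cancel_left_inverse:
  assumes "arr W X f" "arr W X f'" "arr X Y g" "arr Y X h" "h \<cdot> g = Idn C X" "g \<cdot> f = g \<cdot> f'"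
  shows "f = f'"
  using assms assoc[of W X f Y g X h] assoc[of W X f' Y g X h] idn_left by metis

lemma cancel_right_inverse:
  assumes "arr Y Z f" "arr Y Z f'" "arr X Y g" "arr Y X h" "g \<cdot> h = Idn C Y" "f \<cdot> g = f' \<cdot> g"
  shows "f = f'"
  using assms assoc[of Y X h Y g Z f] assoc[of Y X h Y g Z f'] idn_right by metis

lemma isomorphic_sym: "isomorphic C X Y \<Longrightarrow> isomorphic C Y X"
  by (auto simp: isomorphic_def is_iso_def)

lemma is_iso_cmp:
  assumes "is_iso C X Y f" "is_iso C Y Z g" "X \<in> Ob C" "Y \<in> Ob C" "Z \<in> Ob C"
  shows "is_iso C X Z (g \<cdot> f)"
proof -
  obtain f' where f: "arr X Y f" "arr Y X f'" "f' \<cdot> f = Idn C X" "f \<cdot> f' = Idn C Y"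
    using assms is_isoE by blast
  obtain g' where g: "arr Y Z g" "arr Z Y g'" "g' \<cdot> g = Idn C Y" "g \<cdot> g' = Idn C Z"
    using assms is_isoE by blast
  have "(f' \<cdot> g') \<cdot> g \<cdot> f = f' \<cdot> (g' \<cdot> g) \<cdot> f"
    using assoc[OF arr_cmp[OF f(1) g(1)] g(2) f(2)] assoc[OF f(1) g(1) g(2)] by simp
  moreover have "(g \<cdot> f) \<cdot> f' \<cdot> g' = g \<cdot> (f \<cdot> f') \<cdot> g'"
    using assoc[OF arr_cmp[OF g(2) f(2)] f(1) g(1)] assoc[OF g(2) f(2) f(1)] by simp
  ultimately show ?thesis
    using f g idn_left by (intro is_isoI[of X Z _ "f' \<cdot> g'"] arr_cmp) auto
qed

lemma isomorphic_trans:
  assumes "isomorphic C X Y" "isomorphic C Y Z" "X \<in> Ob C" "Y \<in> Ob C" "Z \<in> Ob C"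
  shows "isomorphic C X Z"
  using assms is_iso_cmp unfolding isomorphic_def by blast

lemma hom_zero_iso_right:
  assumes "hom_zero C W X" "isomorphic C X Y" "W \<in> Ob C" "X \<in> Ob C" "Y \<in> Ob C"
  shows "hom_zero C W Y"
proof -
  obtain f where "is_iso C X Y f" using assms unfolding isomorphic_def by blast
  then obtain g where g: "arr X Y f" "arr Y X g" "f \<cdot> g = Idn C Y"
    using assms(4,5) by (elim is_isoE)
  show ?thesis
  proof (intro hom_zeroI assms)
    fix h assume h: "arr W Y h"
    have "h = f \<cdot> g \<cdot> h" using assoc[OF h g(2,1)] g idn_left[OF h] by simp
    moreover have "g \<cdot> h = zr W X" using hom_zeroD assms g h arr_cmp by blast
    ultimately show "h = zr W Y" using g zero_right assms by metis
  qed
qed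

lemma hom_zero_iso_left:
  assumes "hom_zero C X W" "isomorphic C X Y" "W \<in> Ob C" "X \<in> Ob C" "Y \<in> Ob C"
  shows "hom_zero C Y W"
proof -
  obtain f where "is_iso C X Y f" using assms unfolding isomorphic_def by blast
  then obtain g where g: "arr X Y f" "arr Y X g" "f \<cdot> g = Idn C Y"
    using assms(4,5) by (elim is_isoE)
  show ?thesis
  proof (intro hom_zeroI assms)
    fix h assume h: "arr Y W h"
    have "h = (h \<cdot> f) \<cdot> g" using assoc[OF g(2,1) h] g idn_right[OF h] by simp
    moreover have "h \<cdot> f = zr X W" using hom_zeroD assms g h arr_cmp by blast
    ultimately show "h = zr Y W" using g zero_left assms by metis
  qed
qed

text \<open>Every arrow into or out of \<open>Z\<close> is its own composite with
  \<open>Idn C Z\<close>, so it vanishes with that identity.\<close>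

lemma zero_object_iff: "zero_object C Z \<longleftrightarrow> Z \<in> Ob C \<and> Idn C Z = zr Z Z"
proof
  assume "zero_object C Z"
  then show "Z \<in> Ob C \<and> Idn C Z = zr Z Z"
    unfolding zero_object_def using hom_zeroD arr_idn by blast
next
  assume Z: "Z \<in> Ob C \<and> Idn C Z = zr Z Z"
  have "hom_zero C Z X" "hom_zero C X Z" if "X \<in> Ob C" for X
    using that Z by (auto intro!: hom_zeroI) (metis idn_right zero_right idn_left zero_left)+
  then show "zero_object C Z" using Z by (simp add: zero_object_def)
qed

lemma zero_object_isomorphic:
  assumes "zero_object C Z" "zero_object C Z'"
  shows "isomorphic C Z Z'"
proof -
  have "arr Z Z' (zr Z Z')" "arr Z' Z (zr Z' Z)"
    using assms arr_zero by (auto simp: zero_object_def)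
  moreover from this have "zr Z' Z \<cdot> zr Z Z' = Idn C Z" "zr Z Z' \<cdot> zr Z' Z = Idn C Z'"
    using assms zero_left zero_object_iff by metis+
  ultimately show ?thesis
    unfolding isomorphic_def using is_isoI by blast
qed

section \<open>Finite sums of arrows and direct sums\<close>

lemma arr_finsum:
  assumes "X \<in> Ob C" "Y \<in> Ob C" "\<And>i. i < (n::nat) \<Longrightarrow> arr X Y (f i)"
  shows "arr X Y (finsum (Hom C X Y) f {..<n})"
proof -
  interpret abelian_group "Hom C X Y" using assms arrD hom_abelian_group by blast
  show ?thesis using assms by (auto simp: arr_def intro!: finsum_closed)
qed

lemma finsum_0: "X \<in> Ob C \<Longrightarrow> Y \<in> Ob C \<Longrightarrow> finsum (Hom C X Y) f {..<0::nat} = zr X Y"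
  using hom_abelian_group[of X Y] abelian_monoid.finsum_empty[of "Hom C X Y" f]
  by (simp add: abelian_group_def)

lemma finsum_Suc:
  assumes "X \<in> Ob C" "Y \<in> Ob C" "\<And>i. i < Suc n \<Longrightarrow> arr X Y (f i)"
  shows "finsum (Hom C X Y) f {..<Suc n} = finsum (Hom C X Y) f {..<n} \<oplus>\<^bsub>Hom C X Y\<^esub> f n"
proof -
  interpret abelian_group "Hom C X Y" using assms arrD hom_abelian_group by blast
  have "finsum (Hom C X Y) f (insert n {..<n}) = f n \<oplus>\<^bsub>Hom C X Y\<^esub> finsum (Hom C X Y) f {..<n}"
    using assms by (intro finsum_insert) (auto simp: arr_def)
  then show ?thesis
    using assms arr_finsum[of X Y n f] by (simp add: lessThan_Suc arr_def a_comm)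
qed

lemma finsum_cong_arr:
  assumes "X \<in> Ob C" "Y \<in> Ob C" "\<And>i. i < (n::nat) \<Longrightarrow> arr X Y (f i)" "\<And>i. i < n \<Longrightarrow> f i = g i"
  shows "finsum (Hom C X Y) f {..<n} = finsum (Hom C X Y) g {..<n}"
proof -
  interpret abelian_group "Hom C X Y" using assms arrD hom_abelian_group by blast
  show ?thesis using assms by (intro finsum_cong) (auto simp: arr_def simp_implies_def)
qed

lemma finsum_left:
  assumes "arr X Y f" "Z \<in> Ob C" "\<And>i. i < (n::nat) \<Longrightarrow> arr Y Z (g i)"
  shows "finsum (Hom C Y Z) g {..<n} \<cdot> f = finsum (Hom C X Z) (\<lambda>i. g i \<cdot> f) {..<n}"
  using assms(3)
proof (induction n)
  case 0
  show ?case using assms arrD[OF assms(1)] by (simp only: finsum_0 zero_left)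
next
  case (Suc n)
  have o: "X \<in> Ob C" "Y \<in> Ob C" using assms arrD by auto
  have "finsum (Hom C Y Z) g {..<Suc n} \<cdot> f =
      (finsum (Hom C Y Z) g {..<n} \<oplus>\<^bsub>Hom C Y Z\<^esub> g n) \<cdot> f"
    using finsum_Suc[of Y Z n g] Suc.prems o assms by simp
  also have "\<dots> = finsum (Hom C Y Z) g {..<n} \<cdot> f \<oplus>\<^bsub>Hom C X Z\<^esub> g n \<cdot> f"
    using Suc.prems o assms by (intro add_left arr_finsum) auto
  also have "\<dots> = finsum (Hom C X Z) (\<lambda>i. g i \<cdot> f) {..<Suc n}"
    using Suc o assms by (subst finsum_Suc) (auto intro: arr_cmp)
  finally show ?case .
qed

lemma finsum_right:
  assumes "arr Y Z g" "X \<in> Ob C" "\<And>i. i < (n::nat) \<Longrightarrow> arr X Y (f i)"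
  shows "g \<cdot> finsum (Hom C X Y) f {..<n} = finsum (Hom C X Z) (\<lambda>i. g \<cdot> f i) {..<n}"
  using assms(3)
proof (induction n)
  case 0
  show ?case using assms arrD[OF assms(1)] by (simp only: finsum_0 zero_right)
next
  case (Suc n)
  have o: "Z \<in> Ob C" "Y \<in> Ob C" using assms arrD by auto
  have "g \<cdot> finsum (Hom C X Y) f {..<Suc n} =
      g \<cdot> (finsum (Hom C X Y) f {..<n} \<oplus>\<^bsub>Hom C X Y\<^esub> f n)"
    using finsum_Suc[of X Y n f] Suc.prems o assms by simp
  also have "\<dots> = g \<cdot> finsum (Hom C X Y) f {..<n} \<oplus>\<^bsub>Hom C X Z\<^esub> g \<cdot> f n"
    using Suc.prems o assms by (intro add_right arr_finsum) auto
  also have "\<dots> = finsum (Hom C X Z) (\<lambda>i. g \<cdot> f i) {..<Suc n}"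
    using Suc o assms by (subst finsum_Suc) (auto intro: arr_cmp)
  finally show ?case .
qed

lemma finsum_single:
  assumes "X \<in> Ob C" "Y \<in> Ob C" "j < (n::nat)" "arr X Y (f j)"
    "\<And>i. i < n \<Longrightarrow> i \<noteq> j \<Longrightarrow> f i = zr X Y"
  shows "finsum (Hom C X Y) f {..<n} = f j"
proof -
  interpret abelian_group "Hom C X Y" using assms hom_abelian_group by blast
  have c: "f i \<in> mor C X Y" if "i < n" for i
    using assms that by (cases "i = j") (auto simp: arr_def)
  then have "finsum (Hom C X Y) f {..<n} = finsum (Hom C X Y) (\<lambda>i. if j = i then f i else zr X Y) {..<n}"
    using assms by (intro finsum_cong) (auto simp: arr_def simp_implies_def Pi_def)
  also have "\<dots> = f j"
    using assms(3) c by (intro add.finprod_singleton) auto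
  finally show ?thesis .
qed

lemma is_direct_sumE:
  assumes "is_direct_sum C X n Y" "X \<in> Ob C" "\<And>i. i < n \<Longrightarrow> Y i \<in> Ob C"
  obtains \<iota> \<pi> where "\<And>i. i < n \<Longrightarrow> arr (Y i) X (\<iota> i)" "\<And>i. i < n \<Longrightarrow> arr X (Y i) (\<pi> i)"
    "\<And>i. i < n \<Longrightarrow> \<pi> i \<cdot> \<iota> i = Idn C (Y i)"
    "\<And>i j. i < n \<Longrightarrow> j < n \<Longrightarrow> i \<noteq> j \<Longrightarrow> \<pi> i \<cdot> \<iota> j = zr (Y j) (Y i)"
    "finsum (Hom C X X) (\<lambda>i. \<iota> i \<cdot> \<pi> i) {..<n} = Idn C X"
  using assms unfolding is_direct_sum_def arr_def
  apply (elim exE conjE)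
  subgoal premises p for \<iota> \<pi> by (rule p(1)[of \<iota> \<pi>]) (use p in auto)
  done

text \<open>Uniqueness half of the coproduct property: the resolution of the identity writes an
  arrow out of \<open>X\<close> through its restrictions along the \<open>\<iota> i\<close>.\<close>

lemma direct_sum_ext:
  assumes "X \<in> Ob C" "\<And>i. i < n \<Longrightarrow> arr (Y i) X (\<iota> i)" "\<And>i. i < n \<Longrightarrow> arr X (Y i) (\<pi> i)"
    "finsum (Hom C X X) (\<lambda>i. \<iota> i \<cdot> \<pi> i) {..<n} = Idn C X"
    "arr X W f" "arr X W g" "\<And>i. i < (n::nat) \<Longrightarrow> f \<cdot> \<iota> i = g \<cdot> \<iota> i"
  shows "f = g"
proof -
  have e: "h = finsum (Hom C X W) (\<lambda>i. (h \<cdot> \<iota> i) \<cdot> \<pi> i) {..<n}" if h: "arr X W h" for h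
  proof -
    have "h = h \<cdot> finsum (Hom C X X) (\<lambda>i. \<iota> i \<cdot> \<pi> i) {..<n}"
      using assms h idn_right by metis
    also have "\<dots> = finsum (Hom C X W) (\<lambda>i. h \<cdot> \<iota> i \<cdot> \<pi> i) {..<n}"
      using assms h by (intro finsum_right) (auto intro: arr_cmp)
    also have "\<dots> = finsum (Hom C X W) (\<lambda>i. (h \<cdot> \<iota> i) \<cdot> \<pi> i) {..<n}"
      using assms h arrD[OF h] by (intro finsum_cong_arr) (auto intro: arr_cmp assoc)
    finally show ?thesis .
  qed
  have "finsum (Hom C X W) (\<lambda>i. (f \<cdot> \<iota> i) \<cdot> \<pi> i) {..<n}
      = finsum (Hom C X W) (\<lambda>i. (g \<cdot> \<iota> i) \<cdot> \<pi> i) {..<n}"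
    using assms arrD[of X W f] by (intro finsum_cong_arr) (auto intro: arr_cmp)
  then show ?thesis using e[OF assms(5)] e[OF assms(6)] by simp
qed

text \<open>Existence half: the witness is the sum of the \<open>w i \<cdot> \<pi> i\<close>; after
  composition with \<open>\<iota> j\<close> only the term \<open>w j\<close> survives.\<close>

lemma direct_sum_extend:
  assumes "X \<in> Ob C" "W \<in> Ob C" "\<And>i. i < n \<Longrightarrow> arr (Y i) X (\<iota> i)" "\<And>i. i < n \<Longrightarrow> arr X (Y i) (\<pi> i)"
    "\<And>i. i < n \<Longrightarrow> \<pi> i \<cdot> \<iota> i = Idn C (Y i)"
    "\<And>i j. i < n \<Longrightarrow> j < n \<Longrightarrow> i \<noteq> j \<Longrightarrow> \<pi> i \<cdot> \<iota> j = zr (Y j) (Y i)"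
    "\<And>i. i < (n::nat) \<Longrightarrow> arr (Y i) W (w i)"
  obtains u where "arr X W u" "\<And>i. i < n \<Longrightarrow> u \<cdot> \<iota> i = w i"
proof
  show "arr X W (finsum (Hom C X W) (\<lambda>i. w i \<cdot> \<pi> i) {..<n})"
    using assms(1,2) by (rule arr_finsum) (rule arr_cmp[OF assms(4,7)])
  fix j assume j: "j < n"
  have Y: "Y j \<in> Ob C" using assms(3)[OF j] arrD by blast
  have d: "(w i \<cdot> \<pi> i) \<cdot> \<iota> j = (if i = j then w j else zr (Y j) W)" if i: "i < n" for i
  proof -
    have "(w i \<cdot> \<pi> i) \<cdot> \<iota> j = w i \<cdot> \<pi> i \<cdot> \<iota> j"
      using assoc[OF assms(3)[OF j] assms(4)[OF i] assms(7)[OF i]] by simp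
    then show ?thesis
      using assms(5,6) i j idn_right[OF assms(7)[OF i]] zero_right[OF assms(7)[OF i] Y] by auto
  qed
  have "finsum (Hom C X W) (\<lambda>i. w i \<cdot> \<pi> i) {..<n} \<cdot> \<iota> j
      = finsum (Hom C (Y j) W) (\<lambda>i. (w i \<cdot> \<pi> i) \<cdot> \<iota> j) {..<n}"
    by (rule finsum_left[OF assms(3)[OF j] assms(2)]) (rule arr_cmp[OF assms(4,7)])
  also have "\<dots> = w j"
    using finsum_single[of "Y j" W j n "\<lambda>i. (w i \<cdot> \<pi> i) \<cdot> \<iota> j"] d assms j Y by auto
  finally show "finsum (Hom C X W) (\<lambda>i. w i \<cdot> \<pi> i) {..<n} \<cdot> \<iota> j = w j" .
qed

text \<open>A map out of a summand is recovered from its composite with the projection, a map out of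
  the sum from its restrictions. Classes cut out by vanishing of outgoing maps are thereby closed
  under finite sums and summands.\<close>

lemma hom_zero_direct_sum:
  assumes "is_direct_sum C X n Y" "X \<in> Ob C" "\<And>i. i < n \<Longrightarrow> Y i \<in> Ob C" "W \<in> Ob C"
  shows "hom_zero C X W \<longleftrightarrow> (\<forall>i<n. hom_zero C (Y i) W)"
proof -
  obtain \<iota> \<pi> where d: "\<And>i. i < n \<Longrightarrow> arr (Y i) X (\<iota> i)" "\<And>i. i < n \<Longrightarrow> arr X (Y i) (\<pi> i)"
    "\<And>i. i < n \<Longrightarrow> \<pi> i \<cdot> \<iota> i = Idn C (Y i)"
    "\<And>i j. i < n \<Longrightarrow> j < n \<Longrightarrow> i \<noteq> j \<Longrightarrow> \<pi> i \<cdot> \<iota> j = zr (Y j) (Y i)"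
    "finsum (Hom C X X) (\<lambda>i. \<iota> i \<cdot> \<pi> i) {..<n} = Idn C X"
    using is_direct_sumE[OF assms(1-3)] by blast
  show ?thesis
  proof (intro iffI allI impI)
    fix i assume h: "hom_zero C X W" and i: "i < n"
    show "hom_zero C (Y i) W"
    proof (intro hom_zeroI assms i)
      fix f assume f: "arr (Y i) W f"
      have "f = (f \<cdot> \<pi> i) \<cdot> \<iota> i"
        using assoc[OF d(1,2)[OF i] f] d(3)[OF i] idn_right[OF f] by simp
      also have "\<dots> = zr (Y i) W"
        using hom_zeroD[OF h arr_cmp[OF d(2)[OF i] f]] zero_left[OF d(1)[OF i] assms(4)] by simp
      finally show "f = zr (Y i) W" .
    qed
  next
    assume h: "\<forall>i<n. hom_zero C (Y i) W"
    show "hom_zero C X W"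
    proof (intro hom_zeroI assms)
      fix f assume f: "arr X W f"
      show "f = zr X W"
      proof (rule direct_sum_ext[OF assms(2) d(1,2,5) f])
        show "arr X W (zr X W)" using arr_zero assms by blast
        fix i assume i: "i < n"
        have "hom_zero C (Y i) W" using h i by blast
        then show "f \<cdot> \<iota> i = zr X W \<cdot> \<iota> i"
          using hom_zeroD arr_cmp[OF d(1)[OF i] f] zero_left[OF d(1)[OF i] assms(4)] by simp
      qed
    qed
  qed
qed


subsection \<open>Exchange\<close>

text \<open>
  Unlike locality of the endomorphism ring this includes the zero object, so that it visibly passes
  to heart reflections.
\<close>

definition iso_or_complement_iso :: "'o \<Rightarrow> bool"
  where "iso_or_complement_iso H \<longleftrightarrow>
    (\<forall>a. arr H H a \<longrightarrow> is_iso C H H a \<or> is_iso C H H (sub H H (Idn C H) a))"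

text \<open>\<open>a\<close> and its complement add up to the identity, and in a local ring two
  non-units never add up to a unit.\<close>

lemma local_ring_iso_or_complement_iso:
  assumes "H \<in> Ob C" "local_ring (End_ring C H)"
  shows "iso_or_complement_iso H"
  unfolding iso_or_complement_iso_def
proof (intro allI impI)
  fix a assume a: "arr H H a"
  let ?R = "End_ring C H" and ?b = "sub H H (Idn C H) a"
  have b: "arr H H ?b" using a assms arr_idn arr_sub by blast
  interpret abelian_group "Hom C H H" using assms hom_abelian_group by blast
  have "a \<oplus>\<^bsub>Hom C H H\<^esub> ?b = Idn C H"
    using sub_add[OF arr_idn[OF assms(1)] a] a b a_comm arrD by metis
  then have s: "a \<oplus>\<^bsub>?R\<^esub> ?b = \<one>\<^bsub>?R\<^esub>" by (simp add: End_ring_def)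
  have "ring ?R" using assms local_ring_def by blast
  then have "\<one>\<^bsub>?R\<^esub> \<in> Units ?R" using monoid.Units_one_closed ring.is_monoid by blast
  then have "a \<in> Units ?R \<or> ?b \<in> Units ?R"
    using assms(2) s a b unfolding local_ring_def by (metis DiffI arrD(3) End_ring_def partial_object.simps(1))
  then show "is_iso C H H a \<or> is_iso C H H ?b"
    by (auto simp: Units_def End_ring_def is_iso_def)
qed

text \<open>
  Induction on the number of summands.  If \<open>s p\<close> is invertible for the last pair \<open>p\<close>, \<open>s\<close>, with inverse \<open>u\<close>, then
  \<open>e = p u s\<close> is idempotent and \<open>g - e\<close> is the sum of the remaining terms conjugated by \<open>g - e\<close>.
  If \<open>1 - s p\<close> has the inverse \<open>u\<close>, then \<open>g + p u s\<close> is inverse to \<open>g - p s\<close> in the corner ring of \<open>g\<close>,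
  and the last term can be dropped.
\<close>

lemma idempotent_decomposition:
  assumes "arr P P g" "g \<cdot> g = g"
    "\<And>i. i < (n::nat) \<Longrightarrow> H i \<in> S" "\<And>h. h \<in> S \<Longrightarrow> iso_or_complement_iso h"
    "\<And>i. i < n \<Longrightarrow> arr (H i) P (p i)" "\<And>i. i < n \<Longrightarrow> arr P (H i) (s i)"
    "\<And>i. i < n \<Longrightarrow> g \<cdot> p i = p i" "\<And>i. i < n \<Longrightarrow> s i \<cdot> g = s i"
    "finsum (Hom C P P) (\<lambda>i. p i \<cdot> s i) {..<n} = g"
  shows "\<exists>(m::nat) H' p' s'. (\<forall>i<m. H' i \<in> S \<and> arr (H' i) P (p' i) \<and> arr P (H' i) (s' i) \<and>
      g \<cdot> p' i = p' i \<and> s' i \<cdot> g = s' i) \<and>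
    (\<forall>i<m. \<forall>j<m. s' i \<cdot> p' j = (if i = j then Idn C (H' i) else zr (H' j) (H' i))) \<and>
    finsum (Hom C P P) (\<lambda>i. p' i \<cdot> s' i) {..<m} = g"
  using assms(1,2,3,5-9)
proof (induction n arbitrary: g p s)
  case 0
  show ?case by (intro exI[of _ 0] exI[of _ H] exI[of _ p] exI[of _ s]) (use 0 in simp)
next
  case (Suc n)
  have P: "P \<in> Ob C" using Suc.prems(1) arrD by blast
  note gg = Suc.prems(1,2)
  have ty: "arr (H i) P (p i)" "arr P (H i) (s i)" if "i < Suc n" for i using Suc.prems that by auto
  have pst: "arr P P (p i \<cdot> s i)" if "i < n" for i using arr_cmp[OF ty(2,1)] that by simp
  have H: "H n \<in> Ob C" using ty[of n] arrD by blast
  define a where "a = s n \<cdot> p n"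
  have p: "arr (H n) P (p n)" and s: "arr P (H n) (s n)" and gp: "g \<cdot> p n = p n" and sg: "s n \<cdot> g = s n"
    using Suc.prems by auto
  have a: "arr (H n) (H n) a" using a_def arr_cmp p s by blast
  have ps: "arr P P (p n \<cdot> s n)" using arr_cmp p s by blast
  have sum: "finsum (Hom C P P) (\<lambda>i. p i \<cdot> s i) {..<n} = sub P P g (p n \<cdot> s n)" (is "?T = _")
  proof -
    have "?T \<oplus>\<^bsub>Hom C P P\<^esub> (p n \<cdot> s n) = g"
      using finsum_Suc[OF P P, of n "\<lambda>i. p i \<cdot> s i"] Suc.prems(8) arr_cmp[OF ty(2) ty(1)] by simp
    moreover have "arr P P ?T" by (rule arr_finsum[OF P P]) (rule pst)
    ultimately show ?thesis using sub_eqI[OF gg(1) ps, of ?T] by simp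
  qed
  have "iso_or_complement_iso (H n)" using Suc.prems(3) assms(4) by blast
  then consider "is_iso C (H n) (H n) a" | "is_iso C (H n) (H n) (sub (H n) (H n) (Idn C (H n)) a)"
    using a unfolding iso_or_complement_iso_def by blast
  then show ?case
  proof cases
    case 1
    obtain u where u: "arr (H n) (H n) u" "u \<cdot> a = Idn C (H n)" "a \<cdot> u = Idn C (H n)"
      using is_isoE[OF 1 H H] by blast
    \<comment> \<open>Rescaling \<open>s n\<close> by \<open>u\<close> makes
      \<open>r \<cdot> p n\<close> the identity, so that \<open>e\<close> is a projection onto a
      copy of \<open>H n\<close>.\<close>
    define r where "r = u \<cdot> s n"
    define e where "e = p n \<cdot> r"
    have r: "arr P (H n) r" using r_def u s arr_cmp by blast
    have e: "arr P P e" using e_def p r arr_cmp by blast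
    have rp: "r \<cdot> p n = Idn C (H n)" using assoc[OF p s u(1)] r_def a_def u by simp
    have ep: "e \<cdot> p n = p n" using assoc[OF p r p] e_def rp idn_right[OF p] by simp
    have re: "r \<cdot> e = r" using assoc[OF r p r] e_def rp idn_left[OF r] by simp
    have ee: "e \<cdot> e = e" using assoc[OF r p e] e_def ep by simp
    have rg: "r \<cdot> g = r" using assoc[OF gg(1) s u(1)] r_def sg by simp
    have eg: "e \<cdot> g = e" using assoc[OF gg(1) r p] e_def rg by simp
    have ge: "g \<cdot> e = e" using assoc[OF r p gg(1)] e_def gp by simp
    define f where "f = sub P P g e"
    have f: "arr P P f" using f_def gg e arr_sub by blast
    have fp: "f \<cdot> p n = zr (H n) P" using sub_left[OF p gg(1) e] f_def gp ep sub_self[OF p] by simp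
    have rf: "r \<cdot> f = zr P (H n)" using sub_right[OF gg(1) e r] f_def rg re sub_self[OF r] by simp
    have fg: "f \<cdot> g = f" using sub_left[OF gg(1) gg(1) e] f_def gg eg by simp
    have gf: "g \<cdot> f = f" using sub_right[OF gg(1) e gg(1)] f_def gg ge by simp
    have fe: "f \<cdot> e = zr P P" using sub_left[OF e gg(1) e] f_def ge ee sub_self[OF e] by simp
    have ff: "f \<cdot> f = f" using sub_right[OF gg(1) e f] f_def fg fe sub_zero[OF f] by simp
    define p1 where "p1 i = f \<cdot> p i" for i
    define s1 where "s1 i = s i \<cdot> f" for i
    have t1: "arr (H i) P (p1 i)" "arr P (H i) (s1 i)" if "i < n" for i
      using ty[of i] that f arr_cmp p1_def s1_def by auto
    have t2: "f \<cdot> p1 i = p1 i" "s1 i \<cdot> f = s1 i" if "i < n" for i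
      using assoc[OF ty(1)[of i] f f] assoc[OF f f ty(2)[of i]] that ff by (auto simp: p1_def s1_def)
    have "finsum (Hom C P P) (\<lambda>i. p1 i \<cdot> s1 i) {..<n}
        = finsum (Hom C P P) (\<lambda>i. (f \<cdot> p i \<cdot> s i) \<cdot> f) {..<n}"
    proof (rule finsum_cong_arr[OF P P])
      fix i assume i: "i < n"
      then have i': "i < Suc n" by simp
      show "arr P P (p1 i \<cdot> s1 i)" using t1[OF i] arr_cmp by blast
      show "p1 i \<cdot> s1 i = (f \<cdot> p i \<cdot> s i) \<cdot> f"
        using assoc[OF f ty(2)[OF i'] t1(1)[OF i]] assoc[OF ty(2,1)[OF i'] f] by (simp add: p1_def s1_def)
    qed
    also have "\<dots> = finsum (Hom C P P) (\<lambda>i. f \<cdot> p i \<cdot> s i) {..<n} \<cdot> f"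
      by (rule finsum_left[OF f P, symmetric]) (rule arr_cmp[OF pst f])
    also have "finsum (Hom C P P) (\<lambda>i. f \<cdot> p i \<cdot> s i) {..<n} = f \<cdot> ?T"
      by (rule finsum_right[OF f P, symmetric]) (rule pst)
    also have "f \<cdot> ?T = f"
      using sub_right[OF gg(1) ps f] assoc[OF s p f] fp zero_left[OF s P] fg sub_zero[OF f] sum by simp
    also have "f \<cdot> f = f" by (rule ff)
    finally have "finsum (Hom C P P) (\<lambda>i. p1 i \<cdot> s1 i) {..<n} = f" .
    then have "\<exists>(m::nat) H' p' s'. (\<forall>i<m. H' i \<in> S \<and> arr (H' i) P (p' i) \<and> arr P (H' i) (s' i) \<and>
        f \<cdot> p' i = p' i \<and> s' i \<cdot> f = s' i) \<and>
      (\<forall>i<m. \<forall>j<m. s' i \<cdot> p' j = (if i = j then Idn C (H' i) else zr (H' j) (H' i))) \<and>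
      finsum (Hom C P P) (\<lambda>i. p' i \<cdot> s' i) {..<m} = f"
      using f ff t1 t2 Suc.prems(3) by (intro Suc.IH[of f p1 s1]) auto
    then obtain m :: nat and H' p' s' where IH':
      "\<forall>i<m. H' i \<in> S \<and> arr (H' i) P (p' i) \<and> arr P (H' i) (s' i) \<and> f \<cdot> p' i = p' i \<and> s' i \<cdot> f = s' i"
      "\<forall>i<m. \<forall>j<m. s' i \<cdot> p' j = (if i = j then Idn C (H' i) else zr (H' j) (H' i))"
      "finsum (Hom C P P) (\<lambda>i. p' i \<cdot> s' i) {..<m} = f"
      by (elim exE conjE)
    from IH'(1) have IH:
      "\<And>i. i < m \<Longrightarrow> H' i \<in> S" "\<And>i. i < m \<Longrightarrow> arr (H' i) P (p' i)" "\<And>i. i < m \<Longrightarrow> arr P (H' i) (s' i)"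
      "\<And>i. i < m \<Longrightarrow> f \<cdot> p' i = p' i" "\<And>i. i < m \<Longrightarrow> s' i \<cdot> f = s' i"
      by auto
    have HO: "H' i \<in> Ob C" if "i < m" for i using IH(2)[OF that] arrD by blast
    \<comment> \<open>The induction hypothesis decomposes \<open>f\<close>, and \<open>g\<close> is
      the sum of \<open>f\<close> and \<open>e\<close>. The pair \<open>p n\<close>,
      \<open>r\<close> is appended at index \<open>m\<close>; it is orthogonal to the other pairs
      because they are fixed by \<open>f\<close>, while \<open>f \<cdot> p n\<close> and
      \<open>r \<cdot> f\<close> vanish.\<close>
    let ?H = "H'(m := H n)" and ?p = "p'(m := p n)" and ?s = "s'(m := r)"
    have gp': "g \<cdot> p' i = p' i" "s' i \<cdot> g = s' i" if i: "i < m" for i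
      using assoc[OF IH(2)[OF i] f gg(1)] assoc[OF gg(1) f IH(3)[OF i]] IH(4,5)[OF i] gf fg by auto
    have o1: "s' i \<cdot> p n = zr (H n) (H' i)" if i: "i < m" for i
      using assoc[OF p f IH(3)[OF i]] IH(5)[OF i] fp zero_right[OF IH(3)[OF i] H] by simp
    have o2: "r \<cdot> p' i = zr (H' i) (H n)" if i: "i < m" for i
      using assoc[OF IH(2)[OF i] f r] IH(4)[OF i] rf zero_left[OF IH(2)[OF i] H] by simp
    have "finsum (Hom C P P) (\<lambda>i. ?p i \<cdot> ?s i) {..<Suc m}
      = finsum (Hom C P P) (\<lambda>i. ?p i \<cdot> ?s i) {..<m} \<oplus>\<^bsub>Hom C P P\<^esub> ?p m \<cdot> ?s m"
      by (rule finsum_Suc[OF P P])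
        (use IH(2,3) p r in \<open>auto simp: less_Suc_eq intro: arr_cmp\<close>)
    also have "finsum (Hom C P P) (\<lambda>i. ?p i \<cdot> ?s i) {..<m} = finsum (Hom C P P) (\<lambda>i. p' i \<cdot> s' i) {..<m}"
      by (rule finsum_cong_arr[OF P P]) (use arr_cmp[OF IH(3,2)] in auto)
    also have "\<dots> \<oplus>\<^bsub>Hom C P P\<^esub> ?p m \<cdot> ?s m = g"
      using sub_add[OF gg(1) e] IH'(3) e_def f_def by simp
    finally have "finsum (Hom C P P) (\<lambda>i. ?p i \<cdot> ?s i) {..<Suc m} = g" .
    then show ?thesis
      by - (rule exI[of _ "Suc m"], rule exI[of _ ?H], rule exI[of _ ?p], rule exI[of _ ?s],
        use IH(1-3) IH'(2) gp' o1 o2 p r gp rg rp Suc.prems(3) in \<open>auto simp: less_Suc_eq\<close>)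
  next
    case 2
    obtain u where u: "arr (H n) (H n) u" "sub (H n) (H n) (Idn C (H n)) a \<cdot> u = Idn C (H n)"
      using is_isoE[OF 2 H H] by blast
    have us: "arr P (H n) (u \<cdot> s n)" using arr_cmp[OF s u(1)] .
    have pus: "arr P P (p n \<cdot> u \<cdot> s n)" using arr_cmp[OF us p] .
    have gps: "arr P P (sub P P g (p n \<cdot> s n))" using gg ps arr_sub by blast
    \<comment> \<open>This is the formula (1 - ps)^-1 = 1 + p (1 - sp)^-1 s, with \<open>g\<close>
      in the role of 1.\<close>
    define v where "v = g \<oplus>\<^bsub>Hom C P P\<^esub> p n \<cdot> u \<cdot> s n"
    have v: "arr P P v" using v_def arr_add gg pus by blast
    have gpus: "(p n \<cdot> u \<cdot> s n) \<cdot> g = p n \<cdot> u \<cdot> s n"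
      using assoc[OF gg(1) us p] assoc[OF gg(1) s u(1)] sg by simp
    have vg: "v \<cdot> g = v" using add_left[OF gg(1) gg(1) pus] gg gpus v_def by simp
    have psg: "(p n \<cdot> s n) \<cdot> g = p n \<cdot> s n" using assoc[OF gg(1) s p] sg by simp
    have 1: "sub P P g (p n \<cdot> s n) \<cdot> g = sub P P g (p n \<cdot> s n)"
      using sub_left[OF gg(1) gg(1) ps] gg psg by simp
    have 2: "sub P P g (p n \<cdot> s n) \<cdot> p n = p n \<cdot> sub (H n) (H n) (Idn C (H n)) a"
      using sub_left[OF p gg(1) ps] sub_right[OF arr_idn[OF H] a p] gp assoc[OF p s p] idn_right[OF p] a_def
      by simp
    have "sub P P g (p n \<cdot> s n) \<cdot> p n \<cdot> u \<cdot> s n = (sub P P g (p n \<cdot> s n) \<cdot> p n) \<cdot> u \<cdot> s n"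
      using assoc[OF us p gps] .
    also have "\<dots> = p n \<cdot> sub (H n) (H n) (Idn C (H n)) a \<cdot> u \<cdot> s n"
      using assoc[OF us arr_sub[OF arr_idn[OF H] a] p] 2 by simp
    also have "\<dots> = p n \<cdot> s n"
      using assoc[OF s u(1) arr_sub[OF arr_idn[OF H] a]] u idn_left[OF s] by simp
    finally have 3: "sub P P g (p n \<cdot> s n) \<cdot> v = g"
      using add_right[OF gg(1) pus gps] 1 v_def sub_add[OF gg(1) ps] by simp
    \<comment> \<open>The first \<open>n\<close> terms add up to \<open>g\<close> minus the last
      one; multiplying their right factors by \<open>v\<close> makes the sum \<open>g\<close> again,
      with one term fewer.\<close>
    have t: "arr P (H i) (s i \<cdot> v)" if "i < n" for i using ty(2)[of i] that v arr_cmp by auto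
    have "finsum (Hom C P P) (\<lambda>i. p i \<cdot> s i \<cdot> v) {..<n} = finsum (Hom C P P) (\<lambda>i. (p i \<cdot> s i) \<cdot> v) {..<n}"
    proof (rule finsum_cong_arr[OF P P])
      fix i assume i: "i < n"
      then have i': "i < Suc n" by simp
      show "arr P P (p i \<cdot> s i \<cdot> v)" using arr_cmp[OF t[OF i] ty(1)[OF i']] .
      show "p i \<cdot> s i \<cdot> v = (p i \<cdot> s i) \<cdot> v" using assoc[OF v ty(2,1)[OF i']] .
    qed
    also have "\<dots> = ?T \<cdot> v"
      by (rule finsum_left[OF v P, symmetric]) (rule pst)
    also have "\<dots> = g" using 3 sum by simp
    finally have "finsum (Hom C P P) (\<lambda>i. p i \<cdot> s i \<cdot> v) {..<n} = g" .
    moreover have "(s i \<cdot> v) \<cdot> g = s i \<cdot> v" if "i < n" for i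
      using assoc[OF gg(1) v ty(2)[of i]] that vg by simp
    ultimately show ?thesis
      by (intro Suc.IH[of g p "\<lambda>i. s i \<cdot> v"]) (use gg t ty Suc.prems(3,6) in auto)
  qed
qed


subsection \<open>Autoequivalences\<close>

lemma endofunctor_Ob: "linear_endofunctor K C F F' \<Longrightarrow> X \<in> Ob C \<Longrightarrow> F X \<in> Ob C"
  by (simp add: linear_endofunctor_def)

lemma endofunctor_arr:
  "linear_endofunctor K C F F' \<Longrightarrow> arr X Y f \<Longrightarrow> arr (F X) (F Y) (F' f)"
  by (simp add: linear_endofunctor_def arr_def)

lemma endofunctor_cmp:
  "linear_endofunctor K C F F' \<Longrightarrow> arr X Y f \<Longrightarrow> arr Y Z g \<Longrightarrow> F' (g \<cdot> f) = F' g \<cdot> F' f"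
  unfolding linear_endofunctor_def arr_def by blast

lemma endofunctor_zero:
  assumes "linear_endofunctor K C F F'" "X \<in> Ob C" "Y \<in> Ob C"
  shows "F' (zr X Y) = zr (F X) (F Y)"
proof (rule cancel_add)
  have z: "arr X Y (zr X Y)" using assms arr_zero by blast
  show "arr (F X) (F Y) (F' (zr X Y))" "arr (F X) (F Y) (F' (zr X Y))"
    using endofunctor_arr[OF assms(1) z] by auto
  have "F' (zr X Y \<oplus>\<^bsub>Hom C X Y\<^esub> zr X Y) = F' (zr X Y) \<oplus>\<^bsub>Hom C (F X) (F Y)\<^esub> F' (zr X Y)"
    using assms(1) z unfolding linear_endofunctor_def arr_def by blast
  then show "F' (zr X Y) \<oplus>\<^bsub>Hom C (F X) (F Y)\<^esub> F' (zr X Y) = F' (zr X Y)"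
    using add_zero_left[OF z] by simp
qed

text \<open>Naturality determines \<open>\<eta> Y \<cdot> f\<close> by \<open>G' f\<close>, and
  \<open>\<eta> Y\<close> can be cancelled. For a composite functor this shows that the inner one is
  faithful; the companion below treats isomorphisms towards the identity.\<close>

lemma natural_iso_right_faithful:
  assumes "natural_iso C (\<lambda>X. X) (\<lambda>f. f) G G' \<eta>" "\<And>Z. Z \<in> Ob C \<Longrightarrow> G Z \<in> Ob C"
    "arr X Y f" "arr X Y g" "G' f = G' g"
  shows "f = g"
proof -
  have o: "X \<in> Ob C" "Y \<in> Ob C" using assms arrD by auto
  have "is_iso C Y (G Y) (\<eta> Y)" using assms(1) o unfolding natural_iso_def by blast
  moreover have "G Y \<in> Ob C" using assms(2) o by blast
  ultimately obtain h where h: "arr Y (G Y) (\<eta> Y)" "arr (G Y) Y h" "h \<cdot> \<eta> Y = Idn C Y"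
    using is_isoE o by metis
  have "\<eta> Y \<cdot> k = G' k \<cdot> \<eta> X" if "arr X Y k" for k
    using assms(1) that unfolding natural_iso_def arr_def by blast
  then have "\<eta> Y \<cdot> f = \<eta> Y \<cdot> g" using assms by simp
  then show ?thesis using cancel_left_inverse assms(3,4) h by blast
qed

lemma natural_iso_left_faithful:
  assumes "natural_iso C F F' (\<lambda>X. X) (\<lambda>f. f) \<epsilon>" "\<And>Z. Z \<in> Ob C \<Longrightarrow> F Z \<in> Ob C"
    "arr X Y f" "arr X Y g" "F' f = F' g"
  shows "f = g"
proof -
  have o: "X \<in> Ob C" "Y \<in> Ob C" using assms arrD by auto
  have "is_iso C (F X) X (\<epsilon> X)" using assms(1) o unfolding natural_iso_def by blast
  moreover have "F X \<in> Ob C" using assms(2) o by blast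
  ultimately obtain h where h: "arr (F X) X (\<epsilon> X)" "arr X (F X) h" "\<epsilon> X \<cdot> h = Idn C X"
    using is_isoE o by metis
  have "\<epsilon> Y \<cdot> F' k = k \<cdot> \<epsilon> X" if "arr X Y k" for k
    using assms(1) that unfolding natural_iso_def arr_def by blast
  then have "f \<cdot> \<epsilon> X = g \<cdot> \<epsilon> X" using assms by metis
  then show ?thesis using cancel_right_inverse assms(3,4) h by blast
qed

lemma autoequivalence_faithful:
  assumes "linear_autoequivalence K C F F'" "arr X Y f" "arr X Y g" "F' f = F' g"
  shows "f = g"
proof -
  obtain G G' \<eta> where "linear_endofunctor K C F F'" "linear_endofunctor K C G G'"
    "natural_iso C (\<lambda>X. X) (\<lambda>f. f) (G \<circ> F) (G' \<circ> F') \<eta>"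
    using assms(1) unfolding linear_autoequivalence_def by blast
  then show ?thesis
    using natural_iso_right_faithful[OF _ _ assms(2,3), of "G \<circ> F" "G' \<circ> F'" \<eta>] assms(4)
    by (simp add: linear_endofunctor_def)
qed

text \<open>The preimage of \<open>h\<close> is \<open>G' h\<close> transported along the unit
  \<open>\<eta>\<close>. Naturality gives \<open>G' (F' f) = G' h\<close>, and \<open>G'\<close> is
  faithful because \<open>F \<circ> G\<close> is isomorphic to the identity.\<close>

lemma autoequivalence_full:
  assumes "linear_autoequivalence K C F F'" "X \<in> Ob C" "Y \<in> Ob C" "arr (F X) (F Y) h"
  obtains f where "arr X Y f" "F' f = h"
proof -
  obtain G G' \<eta> \<epsilon> where F: "linear_endofunctor K C F F'" and G: "linear_endofunctor K C G G'"
    and \<eta>: "natural_iso C (\<lambda>X. X) (\<lambda>f. f) (G \<circ> F) (G' \<circ> F') \<eta>"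
    and \<epsilon>: "natural_iso C (F \<circ> G) (F' \<circ> G') (\<lambda>X. X) (\<lambda>f. f) \<epsilon>"
    using assms(1) unfolding linear_autoequivalence_def by blast
  have GF: "G (F Z) \<in> Ob C" if "Z \<in> Ob C" for Z
    using endofunctor_Ob[OF G endofunctor_Ob[OF F that]] .
  have "is_iso C X (G (F X)) (\<eta> X)" "is_iso C Y (G (F Y)) (\<eta> Y)"
    using \<eta> assms unfolding natural_iso_def by auto
  then obtain x y where x: "arr X (G (F X)) (\<eta> X)" "arr (G (F X)) X x" "\<eta> X \<cdot> x = Idn C (G (F X))"
    and y: "arr Y (G (F Y)) (\<eta> Y)" "arr (G (F Y)) Y y" "\<eta> Y \<cdot> y = Idn C (G (F Y))"
    using is_isoE GF assms(2,3) by metis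
  have Gh: "arr (G (F X)) (G (F Y)) (G' h)" using endofunctor_arr[OF G assms(4)] .
  define f where "f = y \<cdot> G' h \<cdot> \<eta> X"
  have Ghx: "arr X (G (F Y)) (G' h \<cdot> \<eta> X)" using arr_cmp x Gh by blast
  have f: "arr X Y f" using f_def arr_cmp Ghx y by blast
  have "\<eta> Y \<cdot> f = G' h \<cdot> \<eta> X" using assoc[OF Ghx y(2,1)] y f_def idn_left[OF Ghx] by simp
  moreover have "\<eta> Y \<cdot> f = G' (F' f) \<cdot> \<eta> X"
    using \<eta> f unfolding natural_iso_def arr_def by auto
  ultimately have "G' (F' f) = G' h"
    using cancel_right_inverse[OF _ Gh x] endofunctor_arr[OF G endofunctor_arr[OF F f]] by simp
  then have "F' f = h"
    using natural_iso_left_faithful[OF \<epsilon> _ endofunctor_arr[OF F f] assms(4)] F G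
    by (simp add: linear_endofunctor_def)
  then show ?thesis using that f by blast
qed

lemma autoequivalence_essentially_surjective:
  assumes "linear_autoequivalence K C F F'" "X \<in> Ob C"
  obtains Y where "Y \<in> Ob C" "isomorphic C (F Y) X"
proof -
  obtain G G' \<epsilon> where "linear_endofunctor K C G G'"
    "natural_iso C (F \<circ> G) (F' \<circ> G') (\<lambda>X. X) (\<lambda>f. f) \<epsilon>"
    using assms(1) unfolding linear_autoequivalence_def by blast
  then show ?thesis
    using that[of "G X"] assms(2) unfolding linear_endofunctor_def natural_iso_def isomorphic_def
    by auto
qed

end


section \<open>Triangulated categories\<close>

lemma (in additive_category) zero_object_exists:
  obtains N where "zero_object C N"
proof -
  obtain X where X: "X \<in> Ob C" "is_direct_sum C X 0 undefined"
    using direct_sums[of 0 undefined] by auto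
  obtain \<iota> \<pi> where "finsum (Hom C X X) (\<lambda>i. \<iota> i \<cdot> \<pi> i) {..<0::nat} = Idn C X"
    using is_direct_sumE[OF X(2,1)] by auto
  then show ?thesis using that[of X] X finsum_0 zero_object_iff by metis
qed

context triangulated_category
begin

notation comp (infixr "\<cdot>" 70)

lemma shift_endofunctor: "linear_endofunctor K D (Sh D) (Shm D)"
  using shift_autoequivalence linear_autoequivalence_def by blast

lemma shift_Ob: "X \<in> Ob D \<Longrightarrow> Sh D X \<in> Ob D"
  using endofunctor_Ob[OF shift_endofunctor] .

lemmas shift_arr = endofunctor_arr[OF shift_endofunctor]
  and shift_cmp = endofunctor_cmp[OF shift_endofunctor]
  and shift_zero = endofunctor_zero[OF shift_endofunctor]
  and shift_faithful = autoequivalence_faithful[OF shift_autoequivalence]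
  and shift_full = autoequivalence_full[OF shift_autoequivalence]
  and shift_essentially_surjective = autoequivalence_essentially_surjective[OF shift_autoequivalence]

lemma shift_idn: "X \<in> Ob D \<Longrightarrow> Shm D (Idn D X) = Idn D (Sh D X)"
  using shift_endofunctor by (simp add: linear_endofunctor_def)

lemma shift_zero_object: "zero_object D N \<Longrightarrow> zero_object D (Sh D N)"
  using shift_idn[of N] shift_zero[of N N] shift_Ob[of N] by (simp add: zero_object_iff)

lemma shift_hom_zero:
  assumes "hom_zero D X Y" "X \<in> Ob D" "Y \<in> Ob D"
  shows "hom_zero D (Sh D X) (Sh D Y)"
proof (intro hom_zeroI shift_Ob assms)
  fix h assume "arr (Sh D X) (Sh D Y) h"
  then obtain f where "arr X Y f" "Shm D f = h" using shift_full assms by blast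
  then show "h = zr (Sh D X) (Sh D Y)" using hom_zeroD assms shift_zero by metis
qed

section \<open>Exactness properties of distinguished triangles\<close>

lemma dist_arr:
  assumes "Dist D X Y Z f g h"
  shows "arr X Y f" "arr Y Z g" "arr Z (Sh D X) h"
  using dist_triangle[OF assms] shift_Ob by (auto simp: is_triangle_def arr_def)

lemma dist_rotate:
  assumes "Dist D X Y Z f g h"
  shows "Dist D Y Z (Sh D X) g h (\<ominus>\<^bsub>Hom D (Sh D X) (Sh D Y)\<^esub> Shm D f)"
  using TR2_rotate[OF dist_triangle[OF assms]] assms by blast

text \<open>\<open>Idn D X\<close> and \<open>f\<close> extend to a morphism from the identity
  triangle of \<open>X\<close> to the given one, which makes \<open>g \<cdot> f\<close> factor
  through a zero object.\<close>

lemma dist_comp_zero: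
  assumes "Dist D X Y Z f g h"
  shows "g \<cdot> f = zr X Z"
proof -
  obtain N where N: "zero_object D N" using zero_object_exists .
  note a = dist_arr[OF assms]
  have X: "X \<in> Ob D" "Z \<in> Ob D" "N \<in> Ob D" using a arrD zero_object_iff N by auto
  obtain c where "c \<in> mor D N Z" "c \<cdot> zr X N = g \<cdot> f"
    using TR3[OF TR1_idn[OF X(1) N] assms, of "Idn D X" f] a arr_idn[OF X(1)] idn_right[OF a(1)] arrD
    by blast
  then show ?thesis using zero_right[of N Z c X] X arrI by simp
qed

text \<open>The rotation is the identity triangle of \<open>W\<close> with zero object
  \<open>Sh D N\<close>, so \<open>TR2_rotate\<close> is read backwards; the sign disappears because
  the rotated map is zero.\<close>

lemma dist_zero_idn:
  assumes "W \<in> Ob D" "zero_object D N"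
  shows "Dist D N W W (zr N W) (Idn D W) (zr W (Sh D N))"
proof -
  have N: "N \<in> Ob D" using assms zero_object_iff by blast
  have "arr (Sh D N) (Sh D W) (\<ominus>\<^bsub>Hom D (Sh D N) (Sh D W)\<^esub> Shm D (zr N W))"
    using arr_uminus shift_arr arr_zero assms N by blast
  then have "\<ominus>\<^bsub>Hom D (Sh D N) (Sh D W)\<^esub> Shm D (zr N W) = zr (Sh D N) (Sh D W)"
    using shift_zero_object assms hom_zeroD shift_Ob unfolding zero_object_def by blast
  moreover have "is_triangle D N W W (zr N W) (Idn D W) (zr W (Sh D N))"
    using arr_zero arr_idn assms N shift_Ob by (simp add: is_triangle_def arr_def)
  ultimately show ?thesis
    using TR2_rotate TR1_idn[OF assms(1) shift_zero_object[OF assms(2)]] by simp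
qed

text \<open>Exactness of Hom into \<open>W\<close>: the condition makes \<open>a\<close> and a zero
  map part of a morphism to the triangle \<open>N \<rightarrow> W \<rightarrow> W\<close>, and the
  component supplied by \<open>TR3\<close> is the extension.\<close>

lemma dist_extend:
  assumes "Dist D X Y Z f g h" "arr Y W a" "a \<cdot> f = zr X W"
  obtains b where "arr Z W b" "b \<cdot> g = a"
proof -
  obtain N where N: "zero_object D N" using zero_object_exists .
  note d = dist_arr[OF assms(1)]
  have X: "X \<in> Ob D" "Z \<in> Ob D" "N \<in> Ob D" "W \<in> Ob D" using d assms arrD zero_object_iff N by auto
  have x: "arr X N (zr X N)" "arr N W (zr N W)" using X arr_zero by auto
  have "a \<cdot> f = zr N W \<cdot> zr X N" using assms zero_left[OF x(1) X(4)] by simp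
  then obtain c where "c \<in> mor D Z W" "c \<cdot> g = Idn D W \<cdot> a"
    using TR3[OF assms(1) dist_zero_idn[OF X(4) N] arrD(3)[OF x(1)] arrD(3)[OF assms(2)]] by blast
  then show ?thesis using that X idn_left[OF assms(2)] arrI by metis
qed

text \<open>Exactness of Hom out of \<open>W\<close>. \<open>TR3\<close> completes on the third term
  only, so it is applied to rotated triangles; the resulting map of shifts is brought back by
  fullness of the shift, and the equation by faithfulness.\<close>

lemma dist_lift:
  assumes "Dist D X Y Z f g h" "arr W Y a" "g \<cdot> a = zr W Z"
  obtains b where "arr W X b" "f \<cdot> b = a"
proof -
  obtain N where N: "zero_object D N" using zero_object_exists .
  note d = dist_arr[OF assms(1)]
  have X: "X \<in> Ob D" "Z \<in> Ob D" "N \<in> Ob D" "W \<in> Ob D" using d assms arrD zero_object_iff N by auto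
  have x: "arr N Z (zr N Z)" "arr W N (zr W N)" using X arr_zero by auto
  have e: "zr N Z \<cdot> zr W N = g \<cdot> a" using assms zero_left[OF x(2) X(2)] by simp
  obtain c where c: "c \<in> mor D (Sh D W) (Sh D X)"
    "Shm D a \<cdot> (\<ominus>\<^bsub>Hom D (Sh D W) (Sh D W)\<^esub> Shm D (Idn D W)) =
      (\<ominus>\<^bsub>Hom D (Sh D X) (Sh D Y)\<^esub> Shm D f) \<cdot> c"
    using TR3[OF dist_rotate[OF TR1_idn[OF X(4) N]] dist_rotate[OF assms(1)]
        arrD(3)[OF assms(2)] arrD(3)[OF x(1)] e] by blast
  have "arr (Sh D W) (Sh D X) c" using c(1) shift_Ob X arrI by simp
  then obtain b where b: "arr W X b" "Shm D b = c" using shift_full[OF X(4,1)] by blast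
  have fb: "arr W Y (f \<cdot> b)" using arr_cmp b d by blast
  have "\<ominus>\<^bsub>Hom D (Sh D W) (Sh D Y)\<^esub> Shm D a = \<ominus>\<^bsub>Hom D (Sh D W) (Sh D Y)\<^esub> Shm D (f \<cdot> b)"
    using c(2) b uminus_right[OF shift_arr[OF arr_idn[OF X(4)]] shift_arr[OF assms(2)]]
      uminus_left[OF shift_arr[OF b(1)] shift_arr[OF d(1)]] shift_cmp[OF b(1) d(1)]
      shift_cmp[OF arr_idn[OF X(4)] assms(2)] idn_right[OF assms(2)] by simp
  then have "Shm D a = Shm D (f \<cdot> b)"
    using uminus_inject shift_arr[OF assms(2)] shift_arr[OF fb] by blast
  then have "a = f \<cdot> b" using shift_faithful assms(2) fb by blast
  then show ?thesis using that b by blast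
qed

text \<open>The identity of \<open>Y\<close> lifts to a right inverse \<open>r\<close>. The defect
  \<open>c\<close> of \<open>r\<close> as a left inverse is killed by \<open>f\<close>, so its shift
  factors through \<open>Z\<close> and vanishes, and the shift is faithful.\<close>

lemma dist_zero_third_iso:
  assumes "Dist D X Y Z f g h" "zero_object D Z"
  shows "is_iso D X Y f"
proof -
  note d = dist_arr[OF assms(1)]
  have X: "X \<in> Ob D" "Y \<in> Ob D" "Z \<in> Ob D" using d arrD by auto
  have "g \<cdot> Idn D Y = zr Y Z"
    using assms(2) d(2) idn_right hom_zeroD X unfolding zero_object_def by metis
  then obtain r where r: "arr Y X r" "f \<cdot> r = Idn D Y"
    using dist_lift[OF assms(1) arr_idn[OF X(2)]] by blast
  define c where "c = sub X X (r \<cdot> f) (Idn D X)"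
  have rf: "arr X X (r \<cdot> f)" using r d arr_cmp by blast
  have c: "arr X X c" using c_def rf arr_idn[OF X(1)] arr_sub by blast
  have "f \<cdot> r \<cdot> f = f" using assoc[OF d(1) r(1) d(1)] r idn_left[OF d(1)] by simp
  then have fc: "f \<cdot> c = zr X Y"
    using sub_right[OF rf arr_idn[OF X(1)] d(1)] idn_right[OF d(1)] sub_self[OF d(1)] c_def by simp
  then have "Shm D f \<cdot> Shm D c = zr (Sh D X) (Sh D Y)" using shift_cmp[OF c d(1)] shift_zero X by simp
  then have "(\<ominus>\<^bsub>Hom D (Sh D X) (Sh D Y)\<^esub> Shm D f) \<cdot> Shm D c = zr (Sh D X) (Sh D Y)"
    using uminus_left[OF shift_arr[OF c] shift_arr[OF d(1)]] uminus_zero shift_Ob X by simp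
  then obtain b where b: "arr (Sh D X) Z b" "h \<cdot> b = Shm D c"
    using dist_lift[OF dist_rotate[OF dist_rotate[OF assms(1)]] shift_arr[OF c]] by blast
  have "b = zr (Sh D X) Z" using b assms(2) hom_zeroD shift_Ob X unfolding zero_object_def by blast
  then have "Shm D c = Shm D (zr X X)"
    using b zero_right[OF d(3) shift_Ob[OF X(1)]] shift_zero X by simp
  then have "c = zr X X" using shift_faithful c arr_zero X by blast
  then have "r \<cdot> f = Idn D X" using sub_eq_zeroD[OF rf arr_idn[OF X(1)]] c_def by simp
  then show ?thesis using is_isoI d(1) r by blast
qed

text \<open>Three rotations shift every term; their signs are absorbed in the unnamed maps.\<close>

lemma dist_shift:
  assumes "Dist D X Y Z f g h"
  obtains f' g' h' where "Dist D (Sh D X) (Sh D Y) (Sh D Z) f' g' h'"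
  by (rule that[OF dist_rotate[OF dist_rotate[OF dist_rotate[OF assms]]]])

text \<open>For triangles whose middle term is known only up to isomorphism, such as a shift or a
  chosen truncation.\<close>

lemma dist_replace_middle:
  assumes "Dist D X Y Z f g h" "isomorphic D Y Y'" "Y' \<in> Ob D"
  obtains f' g' where "Dist D X Y' Z f' g' h"
proof -
  note d = dist_arr[OF assms(1)]
  have X: "X \<in> Ob D" "Y \<in> Ob D" "Z \<in> Ob D" using d arrD by auto
  obtain b where bi: "is_iso D Y Y' b" using assms unfolding isomorphic_def by blast
  then obtain r where b: "arr Y Y' b" "arr Y' Y r" "r \<cdot> b = Idn D Y" "b \<cdot> r = Idn D Y'"
    using is_isoE X assms by blast
  have "is_triangle D X Y' Z (b \<cdot> f) (g \<cdot> r) h"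
    using arr_cmp[OF d(1) b(1)] arr_cmp[OF b(2) d(2)] d(3) by (simp add: is_triangle_def arr_def)
  then have "Dist D X Y' Z (b \<cdot> f) (g \<cdot> r) h"
    using TR1_iso[OF assms(1) _ is_iso_idn[OF X(1)] bi is_iso_idn[OF X(3)]]
      idn_right[OF arr_cmp[OF d(1) b(1)]] idn_left[OF d(2)] idn_left[OF d(3)] idn_right[OF d(3)]
      assoc[OF b(1,2) d(2)] b(3) idn_right[OF d(2)] shift_idn[OF X(1)] by simp
  then show ?thesis using that by blast
qed

end


section \<open>t-structures\<close>

locale t_category = triangulated_category K D
  for K :: "('k, 'e) ring_scheme" (structure) and D :: "('k, 'o, 'm, 'z) tri_cat_scheme" +
  fixes t :: "'o t_str"
  assumes t_structure: "t_structure D t"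
begin

notation comp (infixr "\<cdot>" 70)

lemma le0_Ob: "X \<in> Le0 t \<Longrightarrow> X \<in> Ob D"
  and ge0_Ob: "X \<in> Ge0 t \<Longrightarrow> X \<in> Ob D"
  and ge1_ge0: "X \<in> Ge1 D t \<Longrightarrow> X \<in> Ge0 t"
  and le0_shift: "X \<in> Le0 t \<Longrightarrow> Sh D X \<in> Le0 t"
  and le0_ge1: "X \<in> Le0 t \<Longrightarrow> Y \<in> Ge1 D t \<Longrightarrow> hom_zero D X Y"
  using t_structure unfolding t_structure_def by auto

lemma le0_iso: "X \<in> Le0 t \<Longrightarrow> isomorphic D X Y \<Longrightarrow> Y \<in> Ob D \<Longrightarrow> Y \<in> Le0 t"
  and ge0_iso: "X \<in> Ge0 t \<Longrightarrow> isomorphic D X Y \<Longrightarrow> Y \<in> Ob D \<Longrightarrow> Y \<in> Ge0 t"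
  using t_structure unfolding t_structure_def iso_closed_def by auto

lemma truncation:
  assumes "X \<in> Ob D"
  obtains A B f g h where "A \<in> Le0 t" "B \<in> Ge1 D t" "Dist D A X B f g h"
  using t_structure assms unfolding t_structure_def by blast

lemma heart_Ob: "Z \<in> heart t \<Longrightarrow> Z \<in> Ob D"
  by (simp add: heart_def le0_Ob)

lemma ge1_Ob: "X \<in> Ge1 D t \<Longrightarrow> X \<in> Ob D"
  by (simp add: Ge1_def)

text \<open>With \<open>g\<close> zero, \<open>Idn D B\<close> factors through
  \<open>Sh D A\<close>, which has no nonzero map to \<open>B\<close>. So the third term vanishes
  and \<open>f\<close> is invertible.\<close>

lemma truncation_iso:
  assumes "A \<in> Le0 t" "B \<in> Ge1 D t" "Dist D A X B f g h" "hom_zero D X B"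
  shows "zero_object D B" "is_iso D A X f"
proof -
  note d = dist_arr[OF assms(3)]
  have o: "A \<in> Ob D" "B \<in> Ob D" using d arrD by auto
  have g: "g = zr X B" using hom_zeroD assms(4) d(2) by blast
  have "Idn D B \<cdot> g = zr X B" using idn_left[OF d(2)] g by simp
  then obtain b where b: "arr (Sh D A) B b" "b \<cdot> h = Idn D B"
    using dist_extend[OF dist_rotate[OF assms(3)] arr_idn[OF o(2)]] by blast
  have "b = zr (Sh D A) B" using hom_zeroD le0_ge1[OF le0_shift] assms b by blast
  then have "Idn D B = zr B B" using b zero_left[OF d(3) o(2)] by simp
  then show "zero_object D B" using o zero_object_iff by blast
  then show "is_iso D A X f" using dist_zero_third_iso assms by blast
qed

text \<open>The truncation triangle of such an \<open>X\<close> degenerates. Thus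
  \<open>Le0 t\<close> is the left orthogonal of \<open>Ge1 D t\<close>, and its closure properties
  become questions about vanishing Hom sets.\<close>

lemma le0I:
  assumes "X \<in> Ob D" "\<And>B. B \<in> Ge1 D t \<Longrightarrow> hom_zero D X B"
  shows "X \<in> Le0 t"
proof -
  obtain A B f g h where "A \<in> Le0 t" "B \<in> Ge1 D t" "Dist D A X B f g h"
    using truncation assms(1) by blast
  then show ?thesis
    using truncation_iso(2) le0_iso assms unfolding isomorphic_def by blast
qed

text \<open>Membership in \<open>Ge0 t\<close> comes from the truncation of \<open>Z\<close> itself:
  its third term is a zero object in \<open>Ge1 D t\<close>, hence isomorphic to
  \<open>Z\<close>.\<close>

lemma zero_object_heart:
  assumes "zero_object D Z"
  shows "Z \<in> heart t"
proof -
  have Z: "Z \<in> Ob D" using assms zero_object_iff by blast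
  obtain A B f g h where T: "A \<in> Le0 t" "B \<in> Ge1 D t" "Dist D A Z B f g h"
    using truncation Z by blast
  have "hom_zero D Z B" using assms ge1_Ob[OF T(2)] by (simp add: zero_object_def)
  then have "zero_object D B" using truncation_iso(1)[OF T] by blast
  then have "Z \<in> Ge0 t" using ge0_iso[OF ge1_ge0[OF T(2)] zero_object_isomorphic[OF _ assms] Z] by blast
  moreover have "Z \<in> Le0 t" using le0I[OF Z] assms ge1_Ob by (simp add: zero_object_def)
  ultimately show ?thesis by (simp add: heart_def)
qed

lemma le0_extension:
  assumes "Dist D X Y Z f g h" "X \<in> Le0 t" "Z \<in> Le0 t"
  shows "Y \<in> Le0 t"
proof (rule le0I)
  note d = dist_arr[OF assms(1)]
  show Y: "Y \<in> Ob D" using d arrD by blast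
  fix B assume B: "B \<in> Ge1 D t"
  show "hom_zero D Y B"
  proof (intro hom_zeroI Y ge1_Ob B)
    fix y assume y: "arr Y B y"
    have "y \<cdot> f = zr X B" using hom_zeroD[OF le0_ge1[OF assms(2) B] arr_cmp[OF d(1) y]] .
    then obtain b where b: "arr Z B b" "b \<cdot> g = y" using dist_extend[OF assms(1) y] by blast
    have "b = zr Z B" using hom_zeroD[OF le0_ge1[OF assms(3) B] b(1)] .
    then show "y = zr Y B" using b zero_left[OF d(2) ge1_Ob[OF B]] by simp
  qed
qed

lemma le0_cone: "Dist D X Y Z f g h \<Longrightarrow> X \<in> Le0 t \<Longrightarrow> Y \<in> Le0 t \<Longrightarrow> Z \<in> Le0 t"
  using le0_extension dist_rotate le0_shift by blast

section \<open>Objects of \<open>Le_minus1 D t\<close>, and truncation one degree lower\<close>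

lemma le_minus1_Ob: "L \<in> Le_minus1 D t \<Longrightarrow> L \<in> Ob D"
  by (simp add: Le_minus1_def)

lemma le_minus1_le0: "L \<in> Le_minus1 D t \<Longrightarrow> L \<in> Le0 t"
  using le0_iso le0_shift unfolding Le_minus1_def by blast

lemma shift_le_minus1: "X \<in> Le0 t \<Longrightarrow> Sh D X \<in> Le_minus1 D t"
  using is_iso_idn shift_Ob le0_Ob unfolding Le_minus1_def isomorphic_def by blast

lemma le_minus1_iso:
  "L \<in> Le_minus1 D t \<Longrightarrow> isomorphic D L Y \<Longrightarrow> Y \<in> Ob D \<Longrightarrow> Y \<in> Le_minus1 D t"
  using isomorphic_trans shift_Ob le0_Ob unfolding Le_minus1_def by blast

text \<open>Both objects are shifts up to isomorphism, and fullness of the shift reduces the claim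
  to the orthogonality of \<open>Le0 t\<close> and \<open>Ge1 D t\<close>.\<close>

lemma le_minus1_ge0:
  assumes "L \<in> Le_minus1 D t" "Z \<in> Ge0 t"
  shows "hom_zero D L Z"
proof -
  obtain X where X: "X \<in> Le0 t" "isomorphic D (Sh D X) L" using assms(1) unfolding Le_minus1_def by blast
  obtain Y where Y: "Y \<in> Ob D" "isomorphic D (Sh D Y) Z"
    using shift_essentially_surjective ge0_Ob assms(2) by blast
  have "Sh D Y \<in> Ge0 t" using ge0_iso[OF assms(2) isomorphic_sym[OF Y(2)] shift_Ob[OF Y(1)]] .
  then have "hom_zero D X Y" using le0_ge1 X Y unfolding Ge1_def by blast
  then have "hom_zero D (Sh D X) (Sh D Y)" using shift_hom_zero le0_Ob X Y by blast
  then have "hom_zero D (Sh D X) Z"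
    using hom_zero_iso_right Y shift_Ob le0_Ob X ge0_Ob assms by blast
  then show ?thesis
    using hom_zero_iso_left X shift_Ob le0_Ob le_minus1_Ob ge0_Ob assms by blast
qed

text \<open>The shifted truncation triangle of an object \<open>Y\<close> with \<open>Sh D Y\<close>
  isomorphic to \<open>X\<close>.\<close>

lemma truncation_le_minus1:
  assumes "X \<in> Ob D"
  obtains A B f g h where "A \<in> Le_minus1 D t" "B \<in> Ge0 t" "Dist D A X B f g h"
proof -
  obtain Y where Y: "Y \<in> Ob D" "isomorphic D (Sh D Y) X"
    using shift_essentially_surjective assms by blast
  obtain A B f g h where T: "A \<in> Le0 t" "B \<in> Ge1 D t" "Dist D A Y B f g h"
    using truncation Y(1) by blast
  obtain f' g' h' where "Dist D (Sh D A) (Sh D Y) (Sh D B) f' g' h'" using dist_shift T(3) by blast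
  then obtain f'' g'' where "Dist D (Sh D A) X (Sh D B) f'' g'' h'"
    using dist_replace_middle Y(2) assms by blast
  moreover have "Sh D B \<in> Ge0 t" using T(2) unfolding Ge1_def by blast
  ultimately show ?thesis using that shift_le_minus1[OF T(1)] by blast
qed

section \<open>Reflections into the heart and \<open>H0\<close>\<close>

text \<open>\<open>H0\<close> is a choice on objects without an action on maps. This universal
  property stands in for the functor: induced maps come from factorisation, equations between them
  from uniqueness.\<close>

definition heart_reflection :: "'o \<Rightarrow> 'o \<Rightarrow> 'm \<Rightarrow> bool"
  where "heart_reflection Y H q \<longleftrightarrow> arr Y H q \<and> H \<in> heart t \<and>
    (\<forall>Z \<in> heart t. \<forall>w. arr Y Z w \<longrightarrow> (\<exists>!z. arr H Z z \<and> z \<cdot> q = w))"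

lemma heart_reflection_factor:
  assumes "heart_reflection Y H q" "Z \<in> heart t" "arr Y Z w"
  obtains z where "arr H Z z" "z \<cdot> q = w"
  using assms unfolding heart_reflection_def by blast

lemma heart_reflection_unique:
  assumes "heart_reflection Y H q" "Z \<in> heart t" "arr H Z z" "arr H Z z'" "z \<cdot> q = z' \<cdot> q"
  shows "z = z'"
proof -
  have "arr Y Z (z \<cdot> q)" using assms arr_cmp unfolding heart_reflection_def by blast
  then have "\<exists>!x. arr H Z x \<and> x \<cdot> q = z \<cdot> q" using assms unfolding heart_reflection_def by blast
  then show ?thesis using assms by metis
qed

lemma heart_reflection_isomorphic:
  assumes "heart_reflection Y H q" "heart_reflection Y H' q'"
  shows "isomorphic D H H'"
proof -
  have a: "arr Y H q" "H \<in> heart t" "arr Y H' q'" "H' \<in> heart t"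
    using assms unfolding heart_reflection_def by auto
  obtain u where u: "arr H H' u" "u \<cdot> q = q'" using heart_reflection_factor assms(1) a by blast
  obtain v where v: "arr H' H v" "v \<cdot> q' = q" using heart_reflection_factor assms(2) a by blast
  have "(v \<cdot> u) \<cdot> q = Idn D H \<cdot> q" using assoc[OF a(1) u(1) v(1)] u v idn_left[OF a(1)] by simp
  then have 1: "v \<cdot> u = Idn D H"
    using heart_reflection_unique[OF assms(1) a(2)] arr_cmp[OF u(1) v(1)] arr_idn heart_Ob a(2) by blast
  have "(u \<cdot> v) \<cdot> q' = Idn D H' \<cdot> q'" using assoc[OF a(3) v(1) u(1)] u v idn_left[OF a(3)] by simp
  then have "u \<cdot> v = Idn D H'"
    using heart_reflection_unique[OF assms(2) a(4)] arr_cmp[OF v(1) u(1)] arr_idn heart_Ob a(4) by blast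
  then show ?thesis using 1 is_isoI u v unfolding isomorphic_def by blast
qed

text \<open>Factorisations exist because \<open>L\<close> has no nonzero maps to the heart, and are
  unique because \<open>Sh D L\<close> has none: a difference of two vanishes after
  \<open>q\<close>, hence factors through \<open>Sh D L\<close>.\<close>

lemma truncation_heart_reflection:
  assumes "Dist D L Y H i q h" "L \<in> Le_minus1 D t" "H \<in> heart t"
  shows "heart_reflection Y H q"
proof -
  note d = dist_arr[OF assms(1)]
  have "\<exists>!z. arr H Z z \<and> z \<cdot> q = w" if Z: "Z \<in> heart t" and w: "arr Y Z w" for Z w
  proof -
    have Z0: "Z \<in> Ge0 t" "Z \<in> Ob D" using Z heart_Ob by (auto simp: heart_def)
    have "w \<cdot> i = zr L Z" using hom_zeroD[OF le_minus1_ge0[OF assms(2) Z0(1)] arr_cmp[OF d(1) w]] .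
    then obtain z where z: "arr H Z z" "z \<cdot> q = w" using dist_extend[OF assms(1) w] by blast
    have "z' = z" if z': "arr H Z z'" "z' \<cdot> q = w" for z'
    proof -
      have s: "arr H Z (sub H Z z' z)" using arr_sub z z' by blast
      have "sub H Z z' z \<cdot> q = zr Y Z" using sub_left[OF d(2) z'(1) z(1)] z z' sub_self[OF w] by simp
      then obtain b where b: "arr (Sh D L) Z b" "b \<cdot> h = sub H Z z' z"
        using dist_extend[OF dist_rotate[OF assms(1)] s] by blast
      have "b = zr (Sh D L) Z"
        using hom_zeroD[OF le_minus1_ge0[OF shift_le_minus1[OF le_minus1_le0[OF assms(2)]] Z0(1)] b(1)] .
      then have "sub H Z z' z = zr H Z" using b zero_left[OF d(3) Z0(2)] by simp
      then show "z' = z" using sub_eq_zeroD z z' by blast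
    qed
    then show ?thesis using z by blast
  qed
  then show ?thesis using d assms(3) unfolding heart_reflection_def by blast
qed

text \<open>For \<open>Y\<close> in \<open>Le0 t\<close> the chosen \<open>tau_le0 D t Y\<close> is
  isomorphic to \<open>Y\<close>, so the triangle defining \<open>tau_ge0\<close> can be moved to
  \<open>Y\<close>; its third term is in \<open>Le0 t\<close> as the cone of a map in
  \<open>Le0 t\<close>.\<close>

lemma H0_truncation:
  assumes "Y \<in> Le0 t"
  obtains L i q h where "L \<in> Le_minus1 D t" "Dist D L Y (H0 D t Y) i q h" "H0 D t Y \<in> heart t"
proof -
  have Y: "Y \<in> Ob D" using assms le0_Ob by blast
  define A where "A = tau_le0 D t Y"
  have "\<exists>A. A \<in> Le0 t \<and> (\<exists>B\<in>Ge1 D t. \<exists>f g h. Dist D A Y B f g h)" using truncation[OF Y] by metis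
  from someI_ex[OF this] obtain B f g h where A: "A \<in> Le0 t" "B \<in> Ge1 D t" "Dist D A Y B f g h"
    unfolding A_def tau_le0_def by blast
  have AY: "isomorphic D A Y"
    using truncation_iso(2)[OF A le0_ge1[OF assms A(2)]] unfolding isomorphic_def by blast
  define H where "H = H0 D t Y"
  have "\<exists>B. B \<in> Ge0 t \<and> (\<exists>L\<in>Le_minus1 D t. \<exists>f g h. Dist D L A B f g h)"
    using truncation_le_minus1[OF le0_Ob[OF A(1)]] by metis
  from someI_ex[OF this] obtain L i q h where H: "H \<in> Ge0 t" "L \<in> Le_minus1 D t" "Dist D L A H i q h"
    unfolding H_def H0_def tau_ge0_def A_def by blast
  have "H \<in> Le0 t" using le0_cone[OF H(3) le_minus1_le0[OF H(2)] A(1)] .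
  then have "H \<in> heart t" using H by (simp add: heart_def)
  moreover obtain i' q' where "Dist D L Y H i' q' h" using dist_replace_middle[OF H(3) AY Y] .
  ultimately show ?thesis using that[OF H(2)] unfolding H_def by blast
qed

text \<open>Here \<open>q\<close> is zero, so the identity and the zero map of
  \<open>H0 D t Y\<close> agree after \<open>q\<close>. By uniqueness \<open>H0 D t Y\<close> is a
  zero object, and \<open>Y\<close> is isomorphic to \<open>L\<close>.\<close>

lemma le_minus1I:
  assumes "Y \<in> Le0 t" "\<And>Z. Z \<in> heart t \<Longrightarrow> hom_zero D Y Z"
  shows "Y \<in> Le_minus1 D t"
proof -
  obtain L i q h where T: "L \<in> Le_minus1 D t" "Dist D L Y (H0 D t Y) i q h" "H0 D t Y \<in> heart t"
    using H0_truncation assms by blast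
  note d = dist_arr[OF T(2)]
  have H: "H0 D t Y \<in> Ob D" using T heart_Ob by blast
  have z: "arr (H0 D t Y) (H0 D t Y) (zr (H0 D t Y) (H0 D t Y))" using H arr_zero by blast
  have "q = zr Y (H0 D t Y)" using hom_zeroD assms(2) T(3) d(2) by blast
  then have "Idn D (H0 D t Y) \<cdot> q = zr (H0 D t Y) (H0 D t Y) \<cdot> q"
    using idn_left[OF d(2)] zero_left[OF d(2) H] by simp
  then have "Idn D (H0 D t Y) = zr (H0 D t Y) (H0 D t Y)"
    using heart_reflection_unique[OF truncation_heart_reflection[OF T(2,1,3)] T(3) arr_idn[OF H] z]
    by blast
  then have "is_iso D L Y i" using dist_zero_third_iso[OF T(2)] H zero_object_iff by blast
  then show ?thesis using le_minus1_iso[OF T(1)] le0_Ob[OF assms(1)] unfolding isomorphic_def by blast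
qed

section \<open>Cones and epimorphisms of the heart\<close>

text \<open>The last assumption is the epimorphism condition tested on the heart. A map from the
  cone to the heart then vanishes after \<open>g\<close>, so it factors through
  \<open>Sh D X\<close>, which has no nonzero maps there.\<close>

lemma cone_le_minus1I:
  assumes "Dist D X Y C f g h" "X \<in> Le0 t" "Y \<in> Le0 t"
    "\<And>Z z. Z \<in> heart t \<Longrightarrow> arr Y Z z \<Longrightarrow> z \<cdot> f = zr X Z \<Longrightarrow> z = zr Y Z"
  shows "C \<in> Le_minus1 D t"
proof (rule le_minus1I)
  note d = dist_arr[OF assms(1)]
  show "C \<in> Le0 t" using le0_cone assms by blast
  fix Z assume Z: "Z \<in> heart t"
  have o: "Z \<in> Ob D" "C \<in> Ob D" "X \<in> Ob D" using heart_Ob Z d arrD by auto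
  show "hom_zero D C Z"
  proof (intro hom_zeroI o)
    fix c assume c: "arr C Z c"
    have "(c \<cdot> g) \<cdot> f = zr X Z"
      using assoc[OF d(1,2) c] dist_comp_zero[OF assms(1)] zero_right[OF c o(3)] by simp
    then have "c \<cdot> g = zr Y Z" using assms(4)[OF Z arr_cmp[OF d(2) c]] by blast
    then obtain b where b: "arr (Sh D X) Z b" "b \<cdot> h = c"
      using dist_extend[OF dist_rotate[OF assms(1)] c] by blast
    have "b = zr (Sh D X) Z"
      using le_minus1_ge0[OF shift_le_minus1[OF assms(2)]] Z b hom_zeroD unfolding heart_def by blast
    then show "c = zr C Z" using b zero_left[OF d(3) o(1)] by simp
  qed
qed

text \<open>Converse of the criterion above: \<open>z\<close> extends over the cone, which has no
  nonzero maps to the heart.\<close>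

lemma cone_le_minus1D:
  assumes "Dist D X Y C f g h" "C \<in> Le_minus1 D t" "Z \<in> heart t" "arr Y Z z" "z \<cdot> f = zr X Z"
  shows "z = zr Y Z"
proof -
  note d = dist_arr[OF assms(1)]
  obtain b where b: "arr C Z b" "b \<cdot> g = z" using dist_extend[OF assms(1,4,5)] by blast
  have "b = zr C Z" using le_minus1_ge0[OF assms(2)] assms(3) b hom_zeroD unfolding heart_def by blast
  then show ?thesis using b zero_left[OF d(2) heart_Ob[OF assms(3)]] by simp
qed

text \<open>Passing to differences brings epimorphisms into the form of the two cone
  criteria.\<close>

lemma epi_in_heart_iff:
  "epi_in D (heart t) X Y f \<longleftrightarrow> X \<in> heart t \<and> Y \<in> heart t \<and> arr X Y f \<and>
    (\<forall>Z \<in> heart t. \<forall>z. arr Y Z z \<longrightarrow> z \<cdot> f = zr X Z \<longrightarrow> z = zr Y Z)" (is "?L = ?R")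
proof
  assume L: ?L
  then have XY: "X \<in> heart t" "Y \<in> heart t" "arr X Y f"
    using heart_Ob unfolding epi_in_def arr_def by auto
  have "z = zr Y Z" if z: "Z \<in> heart t" "arr Y Z z" "z \<cdot> f = zr X Z" for Z z
  proof -
    have "z \<cdot> f = zr Y Z \<cdot> f" using zero_left[OF XY(3) heart_Ob[OF z(1)]] z by simp
    moreover have "zr Y Z \<in> mor D Y Z" "z \<in> mor D Y Z"
      using arr_zero[of Y Z] heart_Ob z XY arrD by auto
    ultimately show ?thesis using L z(1) unfolding epi_in_def by blast
  qed
  then show ?R using XY by blast
next
  assume R: ?R
  have "g = h" if Z: "Z \<in> heart t" "g \<in> mor D Y Z" "h \<in> mor D Y Z" "g \<cdot> f = h \<cdot> f" for Z g h
  proof -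
    have f: "arr X Y f" and gh: "arr Y Z g" "arr Y Z h" using R Z heart_Ob arrI by auto
    have "sub Y Z g h \<cdot> f = zr X Z" using sub_left[OF f gh] Z(4) sub_self arr_cmp[OF f gh(2)] by simp
    then have "sub Y Z g h = zr Y Z" using R Z(1) arr_sub[OF gh] by blast
    then show ?thesis using sub_eq_zeroD gh by blast
  qed
  then show ?L using R arrD unfolding epi_in_def by blast
qed

section \<open>Lifting properties and direct sums of derived projectives\<close>

lemma dproj_le0: "Q \<in> DProj D t \<Longrightarrow> Q \<in> Le0 t"
  by (simp add: DProj_def)

lemma dproj_shift: "Q \<in> DProj D t \<Longrightarrow> X \<in> Le0 t \<Longrightarrow> hom_zero D Q (Sh D X)"
  by (simp add: DProj_def)

lemma dproj_le_minus1:
  assumes "Q \<in> DProj D t" "L \<in> Le_minus1 D t"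
  shows "hom_zero D Q L"
proof -
  obtain X where X: "X \<in> Le0 t" "isomorphic D (Sh D X) L" using assms(2) unfolding Le_minus1_def by blast
  then show ?thesis
    using hom_zero_iso_right dproj_shift[OF assms(1)] dproj_le0[OF assms(1)] le0_Ob shift_Ob
      le_minus1_Ob[OF assms(2)] by blast
qed

text \<open>The obstruction \<open>g \<cdot> a\<close> is a map from \<open>Q\<close> to
  \<open>Le_minus1 D t\<close>.\<close>

lemma dproj_lift:
  assumes "Dist D X Y C f g h" "C \<in> Le_minus1 D t" "Q \<in> DProj D t" "arr Q Y a"
  obtains b where "arr Q X b" "f \<cdot> b = a"
proof -
  note d = dist_arr[OF assms(1)]
  have "g \<cdot> a = zr Q C" using hom_zeroD dproj_le_minus1 assms arr_cmp[OF assms(4) d(2)] by blast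
  then show ?thesis using dist_lift[OF assms(1,4)] that by blast
qed

text \<open>Here the obstruction is \<open>h \<cdot> a\<close>, a map into the shift of an object of
  \<open>Le0 t\<close>. A typical use is the map from \<open>Y\<close> to \<open>H0 D t Y\<close>,
  whose fibre lies in \<open>Le_minus1 D t\<close>.\<close>

lemma dproj_lift_fiber:
  assumes "Dist D X Y C f g h" "X \<in> Le0 t" "Q \<in> DProj D t" "arr Q C a"
  obtains b where "arr Q Y b" "g \<cdot> b = a"
proof -
  note d = dist_arr[OF assms(1)]
  have "h \<cdot> a = zr Q (Sh D X)" using hom_zeroD dproj_shift assms arr_cmp[OF assms(4) d(3)] by blast
  then show ?thesis using dist_lift[OF dist_rotate[OF assms(1)] assms(4)] that by blast
qed

text \<open>Once \<open>Le0 t\<close> is described as an orthogonal, being derived projective is a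
  vanishing condition on outgoing maps, which settles sums and summands together.\<close>

lemma dproj_direct_sum_iff:
  assumes "is_direct_sum D X n Y" "X \<in> Ob D" "\<And>i. i < n \<Longrightarrow> Y i \<in> Ob D"
  shows "X \<in> DProj D t \<longleftrightarrow> (\<forall>i<n. Y i \<in> DProj D t)"
proof -
  have le0: "Z \<in> Le0 t \<longleftrightarrow> (\<forall>B\<in>Ge1 D t. hom_zero D Z B)" if "Z \<in> Ob D" for Z
    using le0I le0_ge1 that by blast
  have hz: "hom_zero D X W \<longleftrightarrow> (\<forall>i<n. hom_zero D (Y i) W)" if "W \<in> Ob D" for W
    using hom_zero_direct_sum[OF assms that] .
  have dp: "Z \<in> DProj D t \<longleftrightarrow> (\<forall>B\<in>Ge1 D t. hom_zero D Z B) \<and> (\<forall>W\<in>Le0 t. hom_zero D Z (Sh D W))"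
    if "Z \<in> Ob D" for Z
    unfolding DProj_def using le0 that by blast
  show ?thesis
    by (auto simp: dp[OF assms(2)] dp[OF assms(3)] hz ge1_Ob shift_Ob le0_Ob)
qed


section \<open>Derived projective approximations\<close>

lemma le_minus1_cone_approximation:
  assumes "Dist D Q Y C q g h" "C \<in> Le_minus1 D t" "Q \<in> DProj D t"
  shows "right_approximation D (DProj D t) Q Y q"
  unfolding right_approximation_def
proof (intro conjI ballI)
  note d = dist_arr[OF assms(1)]
  show "Q \<in> DProj D t" "q \<in> mor D Q Y" using assms d arrD by auto
  fix Q' f assume Q': "Q' \<in> DProj D t" "f \<in> mor D Q' Y"
  have "arr Q' Y f" using Q' arrI le0_Ob[OF dproj_le0[OF Q'(1)]] arrD(1)[OF d(2)] by blast
  then obtain b where "arr Q' Q b" "q \<cdot> b = f" using dproj_lift[OF assms(1,2) Q'(1)] by blast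
  then show "\<exists>b\<in>mor D Q' Q. q \<cdot> b = f" using arrD by blast
qed

text \<open>An epimorphism \<open>e\<close> of the heart has its cone in
  \<open>Le_minus1 D t\<close>, so \<open>f \<cdot> \<rho>\<close> lifts through \<open>e\<close>,
  and the lift descends along the reflection.\<close>

lemma dproj_reflection_projective:
  assumes "Q \<in> DProj D t" "heart_reflection Q H \<rho>"
  shows "projective_in D (heart t) H"
  unfolding projective_in_def
proof (intro conjI allI impI ballI)
  have \<rho>: "arr Q H \<rho>" and H: "H \<in> heart t" using assms(2) unfolding heart_reflection_def by auto
  show "H \<in> heart t" by (rule H)
  fix M N e f assume e: "epi_in D (heart t) M N e" and f0: "f \<in> mor D H N"
  have MN: "M \<in> heart t" "N \<in> heart t" "arr M N e"
    and epi: "\<And>Z z. Z \<in> heart t \<Longrightarrow> arr N Z z \<Longrightarrow> z \<cdot> e = zr M Z \<Longrightarrow> z = zr N Z"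
    using e unfolding epi_in_heart_iff by auto
  have f: "arr H N f" using f0 H MN heart_Ob arrI by blast
  obtain C g h where C: "Dist D M N C e g h" using TR1_cone MN(3) arrD by metis
  have "C \<in> Le_minus1 D t"
    using cone_le_minus1I[OF C _ _ epi] MN unfolding heart_def by blast
  then obtain b where b: "arr Q M b" "e \<cdot> b = f \<cdot> \<rho>"
    using dproj_lift[OF C _ assms(1) arr_cmp[OF \<rho> f]] by blast
  obtain z where z: "arr H M z" "z \<cdot> \<rho> = b" using heart_reflection_factor[OF assms(2) MN(1) b(1)] .
  have "(e \<cdot> z) \<cdot> \<rho> = f \<cdot> \<rho>" using assoc[OF \<rho> z(1) MN(3)] z b by simp
  then have "e \<cdot> z = f"
    using heart_reflection_unique[OF assms(2) MN(2) arr_cmp[OF z(1) MN(3)] f] by blast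
  then show "\<exists>z\<in>mor D H M. e \<cdot> z = f" using z arrD by blast
qed

lemma enough_dproj_approximation:
  assumes "has_enough_derived_projectives D t" "Y \<in> Le0 t"
  obtains Q C q g h where "Q \<in> DProj D t" "Dist D Q Y C q g h" "C \<in> Le_minus1 D t"
proof -
  define H where "H = H0 D t Y"
  obtain L i p k where T: "L \<in> Le_minus1 D t" "Dist D L Y H i p k" "H \<in> heart t"
    using H0_truncation[OF assms(2)] unfolding H_def by metis
  have rp: "heart_reflection Y H p" using truncation_heart_reflection[OF T(2,1,3)] .
  obtain P e where P: "projective_in D (heart t) P" "epi_in D (heart t) P H e"
    using assms(1) T(3) unfolding has_enough_derived_projectives_def enough_projectives_in_def by blast
  have e: "arr P H e" and Ph: "P \<in> heart t"
    and epi: "\<And>Z z. Z \<in> heart t \<Longrightarrow> arr H Z z \<Longrightarrow> z \<cdot> e = zr P Z \<Longrightarrow> z = zr H Z"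
    using P(2) unfolding epi_in_heart_iff by auto
  obtain Q where Q: "Q \<in> DProj D t" "isomorphic D (H0 D t Q) P"
    using assms(1) P(1) unfolding has_enough_derived_projectives_def has_derived_projectives_def by blast
  define R where "R = H0 D t Q"
  obtain L' i' \<rho> k' where T': "L' \<in> Le_minus1 D t" "Dist D L' Q R i' \<rho> k'" "R \<in> heart t"
    using H0_truncation[OF dproj_le0[OF Q(1)]] unfolding R_def by metis
  have rr: "heart_reflection Q R \<rho>" using truncation_heart_reflection[OF T'(2,1,3)] .
  obtain u where "is_iso D R P u" using Q(2) unfolding R_def isomorphic_def by blast
  then obtain v where u: "arr R P u" "arr P R v" "u \<cdot> v = Idn D P"
    using is_isoE heart_Ob[OF T'(3)] heart_Ob[OF Ph] by metis
  note \<rho> = dist_arr(2)[OF T'(2)] and p = dist_arr(2)[OF T(2)]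
  have u\<rho>: "arr Q P (u \<cdot> \<rho>)" using arr_cmp[OF \<rho> u(1)] .
  \<comment> \<open>The fibre \<open>L\<close> of \<open>p\<close> lies in \<open>Le0 t\<close>, so
    the map from \<open>Q\<close> to \<open>H\<close> through \<open>P\<close> lifts along
    \<open>p\<close>.\<close>
  obtain q where q: "arr Q Y q" "p \<cdot> q = e \<cdot> u \<cdot> \<rho>"
    using dproj_lift_fiber[OF T(2) le_minus1_le0[OF T(1)] Q(1) arr_cmp[OF u\<rho> e]] .
  obtain C g h where C: "Dist D Q Y C q g h" using TR1_cone q(1) arrD by metis
  have "C \<in> Le_minus1 D t"
  proof (rule cone_le_minus1I[OF C dproj_le0[OF Q(1)] assms(2)])
    fix Z z assume Z: "Z \<in> heart t" and z: "arr Y Z z" and zq: "z \<cdot> q = zr Q Z"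
    have o: "Z \<in> Ob D" using heart_Ob Z .
    obtain w where w: "arr H Z w" "w \<cdot> p = z" using heart_reflection_factor[OF rp Z z] .
    have we: "arr P Z (w \<cdot> e)" using arr_cmp[OF e w(1)] .
    \<comment> \<open>The maps \<open>\<rho>\<close>, \<open>u\<close> and \<open>e\<close> are
      cancelled in turn: by the reflection, by the right inverse of \<open>u\<close> and by the
      epimorphism property.\<close>
    have "((w \<cdot> e) \<cdot> u) \<cdot> \<rho> = zr R Z \<cdot> \<rho>"
      using assoc[OF \<rho> u(1) we] assoc[OF u\<rho> e w(1)] assoc[OF q(1) p w(1)] q w zq zero_left[OF \<rho> o]
      by simp
    then have "(w \<cdot> e) \<cdot> u = zr P Z \<cdot> u"
      using heart_reflection_unique[OF rr Z arr_cmp[OF u(1) we] arr_zero[OF heart_Ob[OF T'(3)] o]]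
        zero_left[OF u(1) o] by simp
    then have "w \<cdot> e = zr P Z"
      using cancel_right_inverse[OF we arr_zero[OF heart_Ob[OF Ph] o] u] by blast
    then have "w = zr H Z" using epi[OF Z w(1)] by blast
    then show "z = zr Y Z" using w zero_left[OF p o] by simp
  qed
  then show ?thesis using that[OF Q(1) C] by blast
qed

text \<open>
  Every map from a derived projective to \<open>H\<^sup>0\<close> of the cone lifts to the cone and then to \<open>X\<close>, hence factors
  through the approximation and vanishes; so \<open>H\<^sup>0\<close> of the cone lies in the orthogonal.
\<close>

lemma approximation_cone_le_minus1:
  assumes "right_approximation D (DProj D t) Q X q" "X \<in> Le0 t" "Dist D Q X C q g h"
    "right_perp D (DProj D t) \<inter> heart t \<subseteq> {X. zero_object D X}"
  shows "C \<in> Le_minus1 D t"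
proof -
  note d = dist_arr[OF assms(3)]
  have Q: "Q \<in> DProj D t"
    and app: "\<And>Q' f. Q' \<in> DProj D t \<Longrightarrow> f \<in> mor D Q' X \<Longrightarrow> \<exists>k\<in>mor D Q' Q. q \<cdot> k = f"
    using assms(1) unfolding right_approximation_def by auto
  have C: "C \<in> Le0 t" using le0_cone[OF assms(3) dproj_le0[OF Q] assms(2)] .
  define H where "H = H0 D t C"
  obtain L i p k where T: "L \<in> Le_minus1 D t" "Dist D L C H i p k" "H \<in> heart t"
    using H0_truncation[OF C] unfolding H_def by metis
  note p = dist_arr(2)[OF T(2)]
  have "hom_zero D Q' H" if Q': "Q' \<in> DProj D t" for Q'
  proof (intro hom_zeroI le0_Ob[OF dproj_le0[OF Q']] heart_Ob T(3))
    fix f assume f: "arr Q' H f"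
    have Q'o: "Q' \<in> Ob D" using f arrD by blast
    obtain f' where f': "arr Q' C f'" "p \<cdot> f' = f"
      using dproj_lift_fiber[OF T(2) le_minus1_le0[OF T(1)] Q' f] .
    obtain b where b: "arr Q' X b" "g \<cdot> b = f'"
      using dproj_lift_fiber[OF assms(3) dproj_le0[OF Q] Q' f'(1)] .
    obtain k where k: "k \<in> mor D Q' Q" "q \<cdot> k = b" using app[OF Q' arrD(3)[OF b(1)]] by blast
    have k': "arr Q' Q k" using arrI[OF Q'o arrD(1)[OF d(1)] k(1)] .
    have "f' = zr Q' C"
      using assoc[OF k' d(1,2)] dist_comp_zero[OF assms(3)] zero_left[OF k' arrD(2)[OF d(2)]] b k by simp
    then show "f = zr Q' H" using f' zero_right[OF p Q'o] by simp
  qed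
  then have "zero_object D H" using assms(4) T(3) heart_Ob unfolding right_perp_def by blast
  then have "is_iso D L C i" using dist_zero_third_iso[OF T(2)] by blast
  then show ?thesis using le_minus1_iso[OF T(1)] le0_Ob[OF C] unfolding isomorphic_def by blast
qed

section \<open>Passing decompositions of derived projectives to the heart and back\<close>

text \<open>The inverse of \<open>c\<close> induces an endomorphism \<open>d\<close> of
  \<open>H\<close>, and uniqueness of factorisations makes it inverse to \<open>a\<close>.\<close>

lemma heart_reflection_iso:
  assumes "heart_reflection Q H q" "arr Q Q c" "arr H H a" "q \<cdot> c = a \<cdot> q" "is_iso D Q Q c"
  shows "is_iso D H H a"
proof -
  have q: "arr Q H q" "H \<in> heart t" using assms(1) unfolding heart_reflection_def by auto
  have o: "Q \<in> Ob D" "H \<in> Ob D" using q arrD by auto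
  obtain b where b: "arr Q Q b" "b \<cdot> c = Idn D Q" "c \<cdot> b = Idn D Q" using is_isoE[OF assms(5) o(1,1)] .
  obtain d where d: "arr H H d" "d \<cdot> q = q \<cdot> b"
    using heart_reflection_factor[OF assms(1) q(2) arr_cmp[OF b(1) q(1)]] .
  have "(d \<cdot> a) \<cdot> q = Idn D H \<cdot> q"
    using assoc[OF q(1) assms(3) d(1)] assms(4) assoc[OF assms(2) q(1) d(1)] d(2)
      assoc[OF assms(2) b(1) q(1)] b(2) idn_right[OF q(1)] idn_left[OF q(1)] by simp
  then have 1: "d \<cdot> a = Idn D H"
    using heart_reflection_unique[OF assms(1) q(2) arr_cmp[OF assms(3) d(1)] arr_idn[OF o(2)]] by blast
  have "(a \<cdot> d) \<cdot> q = Idn D H \<cdot> q"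
    using assoc[OF q(1) d(1) assms(3)] d(2) assoc[OF b(1) q(1) assms(3)] assms(4)
      assoc[OF b(1) assms(2) q(1)] b(3) idn_right[OF q(1)] idn_left[OF q(1)] by simp
  then have "a \<cdot> d = Idn D H"
    using heart_reflection_unique[OF assms(1) q(2) arr_cmp[OF d(1) assms(3)] arr_idn[OF o(2)]] by blast
  then show ?thesis using is_isoI[OF assms(3) d(1) 1] by blast
qed

text \<open>\<open>a\<close> lifts to an endomorphism \<open>c\<close> of \<open>Q\<close> because
  the fibre \<open>L\<close> is in \<open>Le0 t\<close>. The complement of \<open>c\<close> then
  lifts that of \<open>a\<close>, and whichever is invertible descends.\<close>

lemma dproj_reflection_iso_or_complement_iso:
  assumes "Q \<in> DProj D t" "iso_or_complement_iso Q" "Dist D L Q H i q h" "L \<in> Le_minus1 D t"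
    "heart_reflection Q H q"
  shows "iso_or_complement_iso H"
  unfolding iso_or_complement_iso_def
proof (intro allI impI)
  fix a assume a: "arr H H a"
  note q = dist_arr(2)[OF assms(3)]
  have o: "Q \<in> Ob D" "H \<in> Ob D" using q arrD by auto
  obtain c where c: "arr Q Q c" "q \<cdot> c = a \<cdot> q"
    using dproj_lift_fiber[OF assms(3) le_minus1_le0[OF assms(4)] assms(1) arr_cmp[OF q a]] .
  have "q \<cdot> sub Q Q (Idn D Q) c = sub H H (Idn D H) a \<cdot> q"
    using sub_right[OF arr_idn[OF o(1)] c(1) q] sub_left[OF q arr_idn[OF o(2)] a] c(2)
      idn_right[OF q] idn_left[OF q] by simp
  then show "is_iso D H H a \<or> is_iso D H H (sub H H (Idn D H) a)"
    using assms(2) c heart_reflection_iso[OF assms(5) c(1) a c(2)]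
      heart_reflection_iso[OF assms(5) arr_sub[OF arr_idn[OF o(1)] c(1)] arr_sub[OF arr_idn[OF o(2)] a]]
    unfolding iso_or_complement_iso_def by blast
qed

text \<open>Additivity of \<open>H0\<close> in terms of reflections: maps are assembled and compared
  summand by summand, through the coproduct properties of \<open>Q\<close> and
  \<open>P\<close>.\<close>

lemma direct_sum_heart_reflection:
  assumes "is_direct_sum D Q n Y" "Q \<in> Ob D" "is_direct_sum D P n H" "P \<in> heart t"
    "\<And>i. i < n \<Longrightarrow> heart_reflection (Y i) (H i) (q i)"
  obtains c where "heart_reflection Q P c"
proof -
  have q: "arr (Y i) (H i) (q i)" if "i < n" for i
    using assms(5)[OF that] unfolding heart_reflection_def by blast
  have YH: "Y i \<in> Ob D" "H i \<in> Ob D" if "i < n" for i using q[OF that] arrD by auto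
  have P: "P \<in> Ob D" using assms(4) heart_Ob by blast
  obtain \<iota> \<pi> where Q: "\<And>i. i < n \<Longrightarrow> arr (Y i) Q (\<iota> i)" "\<And>i. i < n \<Longrightarrow> arr Q (Y i) (\<pi> i)"
    "\<And>i. i < n \<Longrightarrow> \<pi> i \<cdot> \<iota> i = Idn D (Y i)"
    "\<And>i j. i < n \<Longrightarrow> j < n \<Longrightarrow> i \<noteq> j \<Longrightarrow> \<pi> i \<cdot> \<iota> j = zr (Y j) (Y i)"
    "finsum (Hom D Q Q) (\<lambda>i. \<iota> i \<cdot> \<pi> i) {..<n} = Idn D Q"
    using is_direct_sumE[OF assms(1,2) YH(1)] by blast
  obtain \<kappa> \<tau> where R: "\<And>i. i < n \<Longrightarrow> arr (H i) P (\<kappa> i)" "\<And>i. i < n \<Longrightarrow> arr P (H i) (\<tau> i)"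
    "\<And>i. i < n \<Longrightarrow> \<tau> i \<cdot> \<kappa> i = Idn D (H i)"
    "\<And>i j. i < n \<Longrightarrow> j < n \<Longrightarrow> i \<noteq> j \<Longrightarrow> \<tau> i \<cdot> \<kappa> j = zr (H j) (H i)"
    "finsum (Hom D P P) (\<lambda>i. \<kappa> i \<cdot> \<tau> i) {..<n} = Idn D P"
    using is_direct_sumE[OF assms(3) P YH(2)] by blast
  have \<kappa>q: "arr (Y i) P (\<kappa> i \<cdot> q i)" if "i < n" for i using arr_cmp[OF q[OF that] R(1)[OF that]] .
  obtain c where c: "arr Q P c" "\<And>i. i < n \<Longrightarrow> c \<cdot> \<iota> i = \<kappa> i \<cdot> q i"
    by (rule direct_sum_extend[where n = n and Y = Y and \<iota> = \<iota> and \<pi> = \<pi> and w = "\<lambda>i. \<kappa> i \<cdot> q i",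
          OF assms(2) P Q(1-4) \<kappa>q]) (assumption | rule that)+
  have zc: "(z \<cdot> c) \<cdot> \<iota> i = (z \<cdot> \<kappa> i) \<cdot> q i" if z: "arr P Z z" and i: "i < n" for z Z i
    using assoc[OF Q(1)[OF i] c(1) z] assoc[OF q[OF i] R(1)[OF i] z] c(2)[OF i] by simp
  have "\<exists>!z. arr P Z z \<and> z \<cdot> c = w" if Z: "Z \<in> heart t" and w: "arr Q Z w" for Z w
  proof -
    have "\<exists>x. arr (H i) Z x \<and> x \<cdot> q i = w \<cdot> \<iota> i" if i: "i < n" for i
      using heart_reflection_factor[OF assms(5)[OF i] Z arr_cmp[OF Q(1)[OF i] w]] by metis
    then obtain x where x: "\<And>i. i < n \<Longrightarrow> arr (H i) Z (x i)" "\<And>i. i < n \<Longrightarrow> x i \<cdot> q i = w \<cdot> \<iota> i"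
      by metis
    obtain z where z: "arr P Z z" "\<And>i. i < n \<Longrightarrow> z \<cdot> \<kappa> i = x i"
      by (rule direct_sum_extend[where n = n and Y = H and \<iota> = \<kappa> and \<pi> = \<tau> and w = x,
            OF P heart_Ob[OF Z] R(1-4) x(1)]) (assumption | rule that)+
    have zw: "z \<cdot> c = w"
    proof (rule direct_sum_ext[where n = n and Y = Y and \<iota> = \<iota> and \<pi> = \<pi>,
          OF assms(2) Q(1,2,5) arr_cmp[OF c(1) z(1)] w])
      fix i assume i: "i < n"
      show "(z \<cdot> c) \<cdot> \<iota> i = w \<cdot> \<iota> i" using zc[OF z(1) i] z(2)[OF i] x(2)[OF i] by simp
    qed
    have "z' = z" if z': "arr P Z z'" "z' \<cdot> c = w" for z'
    proof (rule direct_sum_ext[where n = n and Y = H and \<iota> = \<kappa> and \<pi> = \<tau>,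
            OF P R(1,2,5) z'(1) z(1)])
      fix i assume i: "i < n"
      have "(z' \<cdot> \<kappa> i) \<cdot> q i = (z \<cdot> \<kappa> i) \<cdot> q i"
        using zc[OF z'(1) i] zc[OF z(1) i] z'(2) zw by simp
      then show "z' \<cdot> \<kappa> i = z \<cdot> \<kappa> i"
        using heart_reflection_unique[OF assms(5)[OF i] Z arr_cmp[OF R(1)[OF i] z'(1)] arr_cmp[OF R(1)[OF i] z(1)]]
        by blast
    qed
    then show ?thesis using z(1) zw by blast
  qed
  then have "heart_reflection Q P c" using c(1) assms(4) unfolding heart_reflection_def by blast
  then show ?thesis using that by blast
qed


lemma krull_schmidt_projective_lift:
  assumes "krull_schmidt D" "projective_in D (heart t) P"
    "Q \<in> DProj D t" "Dist D Q P C q g h" "C \<in> Le_minus1 D t"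
  shows "\<exists>Q \<in> DProj D t. isomorphic D (H0 D t Q) P"
proof -
  have P: "P \<in> heart t" "P \<in> Ob D" using assms(2) heart_Ob unfolding projective_in_def by auto
  have QO: "Q \<in> Ob D" using assms(3) dproj_le0 le0_Ob by blast
  obtain n Y where Y: "\<And>i. i < n \<Longrightarrow> Y i \<in> Ob D" "\<And>i. i < n \<Longrightarrow> local_ring (End_ring D (Y i))"
    and sum: "is_direct_sum D Q n Y"
    using assms(1) QO unfolding krull_schmidt_def by blast
  have YD: "Y i \<in> DProj D t" if "i < n" for i
    using dproj_direct_sum_iff[OF sum QO Y(1)] assms(3) that by blast
  obtain \<iota> \<pi> where ip: "\<And>i. i < n \<Longrightarrow> arr (Y i) Q (\<iota> i)" "\<And>i. i < n \<Longrightarrow> arr Q (Y i) (\<pi> i)"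
    "\<And>i. i < n \<Longrightarrow> \<pi> i \<cdot> \<iota> i = Idn D (Y i)"
    "\<And>i j. i < n \<Longrightarrow> j < n \<Longrightarrow> i \<noteq> j \<Longrightarrow> \<pi> i \<cdot> \<iota> j = zr (Y j) (Y i)"
    "finsum (Hom D Q Q) (\<lambda>i. \<iota> i \<cdot> \<pi> i) {..<n} = Idn D Q"
    using is_direct_sumE[OF sum QO Y(1)] by blast
  have ipa: "arr Q Q (\<iota> i \<cdot> \<pi> i)" if "i < n" for i using arr_cmp[OF ip(2)[OF that] ip(1)[OF that]] .
  \<comment> \<open>Membership in \<open>S\<close> records a derived projective above the object.
    The exchange argument returns members of \<open>S\<close>, so that its output can be
    lifted.\<close>
  define S where "S = {H. iso_or_complement_iso H \<and> (\<exists>Q\<in>DProj D t. \<exists>\<rho>. heart_reflection Q H \<rho>)}"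
  define R where "R = H0 D t Q"
  obtain L i0 \<rho> k0 where T: "L \<in> Le_minus1 D t" "Dist D L Q R i0 \<rho> k0" "R \<in> heart t"
    using H0_truncation[OF dproj_le0[OF assms(3)]] unfolding R_def by metis
  have rr: "heart_reflection Q R \<rho>" using truncation_heart_reflection[OF T(2,1,3)] .
  note \<rho> = dist_arr(2)[OF T(2)] and q = dist_arr(1)[OF assms(4)]
  have RO: "R \<in> Ob D" using T(3) heart_Ob by blast
  have "\<exists>r. heart_reflection (Y i) (H0 D t (Y i)) r \<and> H0 D t (Y i) \<in> S" if i: "i < n" for i
  proof -
    obtain L' i' r k' where T': "L' \<in> Le_minus1 D t" "Dist D L' (Y i) (H0 D t (Y i)) i' r k'"
      "H0 D t (Y i) \<in> heart t"
      using H0_truncation[OF dproj_le0[OF YD[OF i]]] .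
    have r: "heart_reflection (Y i) (H0 D t (Y i)) r"
      using truncation_heart_reflection[OF T'(2,1,3)] .
    then have "iso_or_complement_iso (H0 D t (Y i))"
      using dproj_reflection_iso_or_complement_iso[OF YD[OF i]
          local_ring_iso_or_complement_iso[OF Y(1)[OF i] Y(2)[OF i]] T'(2,1)] by blast
    then show ?thesis using r YD[OF i] unfolding S_def by blast
  qed
  then obtain r where r: "\<And>i. i < n \<Longrightarrow> heart_reflection (Y i) (H0 D t (Y i)) (r i)"
    and S: "\<And>i. i < n \<Longrightarrow> H0 D t (Y i) \<in> S"
    by metis
  define H where "H i = H0 D t (Y i)" for i
  have ra: "arr (Y i) (H i) (r i)" and Hh: "H i \<in> heart t" if "i < n" for i
    using r[OF that] unfolding heart_reflection_def H_def by auto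
  obtain q' where q': "arr R P q'" "q' \<cdot> \<rho> = q" using heart_reflection_factor[OF rr P(1) q] .
  \<comment> \<open>\<open>q'\<close> plays \<open>H0\<close> of \<open>q\<close>. The cone
    condition makes it an epimorphism, so projectivity splits it by \<open>s0\<close> and
    \<open>P\<close> is a retract of \<open>R\<close>.\<close>
  have "epi_in D (heart t) R P q'"
    unfolding epi_in_heart_iff
  proof (intro conjI ballI allI impI T(3) P(1) q'(1))
    fix Z z assume Z: "Z \<in> heart t" and z: "arr P Z z" and "z \<cdot> q' = zr R Z"
    then have "z \<cdot> q = zr Q Z"
      using assoc[OF \<rho> q'(1) z] q'(2) zero_left[OF \<rho> heart_Ob[OF Z]] by simp
    then show "z = zr P Z" using cone_le_minus1D[OF assms(4,5) Z z] by blast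
  qed
  then obtain s0 where "s0 \<in> mor D P R" "q' \<cdot> s0 = Idn D P"
    using assms(2) idn_closed[OF P(2)] unfolding projective_in_def by blast
  then have s0: "arr P R s0" "q' \<cdot> s0 = Idn D P" using arrI P RO by auto
  \<comment> \<open>The \<open>p i\<close> and \<open>\<sigma> i\<close> stand for \<open>H0\<close>
    of \<open>q \<cdot> \<iota> i\<close> and of \<open>\<pi> i\<close>.\<close>
  have "\<exists>x. arr (H i) P x \<and> x \<cdot> r i = q \<cdot> \<iota> i" if "i < n" for i
    using heart_reflection_factor[OF r[OF that] P(1) arr_cmp[OF ip(1)[OF that] q]] unfolding H_def by metis
  then obtain p where p: "\<And>i. i < n \<Longrightarrow> arr (H i) P (p i)" "\<And>i. i < n \<Longrightarrow> p i \<cdot> r i = q \<cdot> \<iota> i"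
    by metis
  have "\<exists>x. arr R (H i) x \<and> x \<cdot> \<rho> = r i \<cdot> \<pi> i" if "i < n" for i
    using heart_reflection_factor[OF rr Hh[OF that] arr_cmp[OF ip(2)[OF that] ra[OF that]]] by metis
  then obtain \<sigma> where \<sigma>: "\<And>i. i < n \<Longrightarrow> arr R (H i) (\<sigma> i)" "\<And>i. i < n \<Longrightarrow> \<sigma> i \<cdot> \<rho> = r i \<cdot> \<pi> i"
    by metis
  have ps: "arr R P (p i \<cdot> \<sigma> i)" if "i < n" for i using arr_cmp[OF \<sigma>(1)[OF that] p(1)[OF that]] .
  \<comment> \<open>The sum is compared with \<open>q'\<close> after \<open>\<rho>\<close>, where it
    becomes \<open>q\<close> composed with the resolution of the identity of
    \<open>Q\<close>.\<close>
  have "finsum (Hom D R P) (\<lambda>i. p i \<cdot> \<sigma> i) {..<n} \<cdot> \<rho>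
      = finsum (Hom D Q P) (\<lambda>i. (p i \<cdot> \<sigma> i) \<cdot> \<rho>) {..<n}"
    by (rule finsum_left[OF \<rho> P(2) ps])
  also have "\<dots> = finsum (Hom D Q P) (\<lambda>i. q \<cdot> \<iota> i \<cdot> \<pi> i) {..<n}"
  proof (rule finsum_cong_arr[OF QO P(2)])
    fix i assume i: "i < n"
    show "arr Q P ((p i \<cdot> \<sigma> i) \<cdot> \<rho>)" using arr_cmp[OF \<rho> ps[OF i]] .
    show "(p i \<cdot> \<sigma> i) \<cdot> \<rho> = q \<cdot> \<iota> i \<cdot> \<pi> i"
      using assoc[OF \<rho> \<sigma>(1)[OF i] p(1)[OF i]] \<sigma>(2)[OF i] assoc[OF ip(2)[OF i] ra[OF i] p(1)[OF i]]
        p(2)[OF i] assoc[OF ip(2)[OF i] ip(1)[OF i] q] by simp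
  qed
  also have "\<dots> = q \<cdot> Idn D Q"
    using finsum_right[where n = n and f = "\<lambda>i. \<iota> i \<cdot> \<pi> i", OF q QO ipa] ip(5) by simp
  also have "\<dots> = q' \<cdot> \<rho>" using idn_right[OF q] q' by simp
  finally have "finsum (Hom D R P) (\<lambda>i. p i \<cdot> \<sigma> i) {..<n} \<cdot> \<rho> = q' \<cdot> \<rho>" .
  moreover have "arr R P (finsum (Hom D R P) (\<lambda>i. p i \<cdot> \<sigma> i) {..<n})"
    by (rule arr_finsum[OF RO P(2) ps])
  ultimately have sq: "finsum (Hom D R P) (\<lambda>i. p i \<cdot> \<sigma> i) {..<n} = q'"
    using heart_reflection_unique[OF rr P(1) _ q'(1)] by blast
  have "finsum (Hom D P P) (\<lambda>i. p i \<cdot> \<sigma> i \<cdot> s0) {..<n}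
      = finsum (Hom D P P) (\<lambda>i. (p i \<cdot> \<sigma> i) \<cdot> s0) {..<n}"
  proof (rule finsum_cong_arr[OF P(2,2)])
    fix i assume i: "i < n"
    show "arr P P (p i \<cdot> \<sigma> i \<cdot> s0)" using arr_cmp[OF arr_cmp[OF s0(1) \<sigma>(1)[OF i]] p(1)[OF i]] .
    show "p i \<cdot> \<sigma> i \<cdot> s0 = (p i \<cdot> \<sigma> i) \<cdot> s0" using assoc[OF s0(1) \<sigma>(1)[OF i] p(1)[OF i]] .
  qed
  also have "\<dots> = Idn D P" using finsum_left[where n = n and g = "\<lambda>i. p i \<cdot> \<sigma> i", OF s0(1) P(2) ps] sq s0(2) by simp
  finally have id: "finsum (Hom D P P) (\<lambda>i. p i \<cdot> \<sigma> i \<cdot> s0) {..<n} = Idn D P" .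
  \<comment> \<open>The pairs \<open>p i\<close>, \<open>\<sigma> i \<cdot> s0\<close> resolve the
    identity of \<open>P\<close> but need not be orthogonal; the exchange argument, with the
    identity as \<open>g\<close>, yields an orthogonal family.\<close>
  have "\<exists>(m::nat) H' p' s'. (\<forall>i<m. H' i \<in> S \<and> arr (H' i) P (p' i) \<and> arr P (H' i) (s' i) \<and>
      Idn D P \<cdot> p' i = p' i \<and> s' i \<cdot> Idn D P = s' i) \<and>
    (\<forall>i<m. \<forall>j<m. s' i \<cdot> p' j = (if i = j then Idn D (H' i) else zr (H' j) (H' i))) \<and>
    finsum (Hom D P P) (\<lambda>i. p' i \<cdot> s' i) {..<m} = Idn D P"
  proof (rule idempotent_decomposition[OF arr_idn[OF P(2)] idn_left[OF arr_idn[OF P(2)]] _ _ _ _ _ _ id])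
    fix i assume i: "i < n"
    show "H i \<in> S" using S[OF i] H_def by simp
    show "arr (H i) P (p i)" by (rule p(1)[OF i])
    show s: "arr P (H i) (\<sigma> i \<cdot> s0)" using arr_cmp[OF s0(1) \<sigma>(1)[OF i]] .
    show "Idn D P \<cdot> p i = p i" using idn_left[OF p(1)[OF i]] .
    show "(\<sigma> i \<cdot> s0) \<cdot> Idn D P = \<sigma> i \<cdot> s0" using idn_right[OF s] .
  next
    fix h assume "h \<in> S"
    then show "iso_or_complement_iso h" by (simp add: S_def)
  qed
  then obtain m :: nat and H' p' s' where m:
    "\<forall>i<m. H' i \<in> S \<and> arr (H' i) P (p' i) \<and> arr P (H' i) (s' i) \<and>
      Idn D P \<cdot> p' i = p' i \<and> s' i \<cdot> Idn D P = s' i"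
    "\<forall>i<m. \<forall>j<m. s' i \<cdot> p' j = (if i = j then Idn D (H' i) else zr (H' j) (H' i))"
    "finsum (Hom D P P) (\<lambda>i. p' i \<cdot> s' i) {..<m} = Idn D P"
    by (elim exE conjE)
  have "is_direct_sum D P m H'"
    unfolding is_direct_sum_def
    by (rule exI[of _ p'], rule exI[of _ s']) (use m arrD in auto)
  moreover have "\<forall>i<m. \<exists>Z. Z \<in> DProj D t \<and> (\<exists>\<rho>. heart_reflection Z (H' i) \<rho>)"
    using m(1) unfolding S_def by blast
  then obtain Z \<rho>' where Z: "\<And>i. i < m \<Longrightarrow> Z i \<in> DProj D t"
    "\<And>i. i < m \<Longrightarrow> heart_reflection (Z i) (H' i) (\<rho>' i)"
    by metis
  have ZO: "Z i \<in> Ob D" if "i < m" for i using Z(1)[OF that] dproj_le0 le0_Ob by blast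
  \<comment> \<open>The sum of the chosen derived projectives reflects onto \<open>P\<close>, and
    also onto its own \<open>H0\<close>; two reflections of one object are isomorphic.\<close>
  obtain X where X: "X \<in> Ob D" "is_direct_sum D X m Z" using direct_sums[of m Z] ZO by blast
  ultimately obtain c where c: "heart_reflection X P c"
    using direct_sum_heart_reflection[OF X(2,1) _ P(1) Z(2)] by blast
  have XD: "X \<in> DProj D t" using dproj_direct_sum_iff[OF X(2,1) ZO] Z(1) by blast
  obtain L' i' x k' where T': "L' \<in> Le_minus1 D t" "Dist D L' X (H0 D t X) i' x k'" "H0 D t X \<in> heart t"
    using H0_truncation[OF dproj_le0[OF XD]] .
  have "isomorphic D (H0 D t X) P"
    using heart_reflection_isomorphic[OF truncation_heart_reflection[OF T'(2,1,3)] c] .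
  then show ?thesis using XD by blast
qed

section \<open>The two directions of the characterisation of enough derived projectives\<close>

lemma enough_derived_projectives_iff:
  assumes "krull_schmidt D"
  shows "has_enough_derived_projectives D t \<longleftrightarrow>
    contravariantly_finite D (DProj D t) (Le0 t) \<and>
    right_perp D (DProj D t) \<inter> heart t = {X. zero_object D X}"
proof
  assume E: "has_enough_derived_projectives D t"
  have "contravariantly_finite D (DProj D t) (Le0 t)"
    unfolding contravariantly_finite_def
  proof (intro conjI ballI subsetI)
    fix Y assume Y: "Y \<in> Le0 t"
    obtain Q C q g h where "Q \<in> DProj D t" "Dist D Q Y C q g h" "C \<in> Le_minus1 D t"
      using enough_dproj_approximation[OF E Y] .
    then show "\<exists>X f. right_approximation D (DProj D t) X Y f"
      using le_minus1_cone_approximation by blast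
  qed (rule dproj_le0)
  moreover have "zero_object D X" if X: "X \<in> right_perp D (DProj D t)" "X \<in> heart t" for X
  proof -
    have XO: "X \<in> Ob D" and X0: "X \<in> Le0 t" using X heart_Ob by (auto simp: heart_def)
    obtain Q C q g h where Q: "Q \<in> DProj D t" "Dist D Q X C q g h" "C \<in> Le_minus1 D t"
      using enough_dproj_approximation[OF E X0] .
    note q = dist_arr(1)[OF Q(2)]
    \<comment> \<open>Orthogonality kills \<open>q\<close>, while the cone in
      \<open>Le_minus1 D t\<close> means that a map from \<open>X\<close> to the heart vanishing
      after \<open>q\<close> is zero; this applies to the identity of \<open>X\<close>.\<close>
    have "q = zr Q X" using X(1) Q(1) hom_zeroD[OF _ q] unfolding right_perp_def by blast
    then have "Idn D X \<cdot> q = zr Q X" using idn_left[OF q] by simp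
    then have "Idn D X = zr X X" using cone_le_minus1D[OF Q(2,3) X(2) arr_idn[OF XO]] by blast
    then show ?thesis using XO zero_object_iff by blast
  qed
  moreover have "X \<in> right_perp D (DProj D t) \<inter> heart t" if "zero_object D X" for X
    using zero_object_heart[OF that] that dproj_le0 le0_Ob
    unfolding right_perp_def zero_object_def by blast
  ultimately show "contravariantly_finite D (DProj D t) (Le0 t) \<and>
    right_perp D (DProj D t) \<inter> heart t = {X. zero_object D X}" by blast
next
  assume A: "contravariantly_finite D (DProj D t) (Le0 t) \<and>
    right_perp D (DProj D t) \<inter> heart t = {X. zero_object D X}"
  \<comment> \<open>Both claims rest on this triangle: for an object of the heart it yields an
    epimorphism from a projective, for a projective the retract to be lifted.\<close>
  have approx: "\<exists>Q C q g h. Q \<in> DProj D t \<and> Dist D Q X C q g h \<and> C \<in> Le_minus1 D t"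
    if X: "X \<in> Le0 t" for X
  proof -
    obtain Q q where Q: "right_approximation D (DProj D t) Q X q"
      using A X unfolding contravariantly_finite_def by blast
    then have q: "Q \<in> DProj D t" "q \<in> mor D Q X" unfolding right_approximation_def by auto
    obtain C g h where C: "Dist D Q X C q g h"
      using TR1_cone[OF le0_Ob[OF dproj_le0[OF q(1)]] le0_Ob[OF X] q(2)] by blast
    show ?thesis using approximation_cone_le_minus1[OF Q X C] A q(1) C by blast
  qed
  have "enough_projectives_in D (heart t)"
    unfolding enough_projectives_in_def
  proof
    fix X assume X: "X \<in> heart t"
    then have "X \<in> Le0 t" by (simp add: heart_def)
    then obtain Q C q g h where Q: "Q \<in> DProj D t" "Dist D Q X C q g h" "C \<in> Le_minus1 D t"
      using approx by blast
    define R where "R = H0 D t Q"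
    obtain L i \<rho> k where T: "L \<in> Le_minus1 D t" "Dist D L Q R i \<rho> k" "R \<in> heart t"
      using H0_truncation[OF dproj_le0[OF Q(1)]] unfolding R_def by metis
    have rr: "heart_reflection Q R \<rho>" using truncation_heart_reflection[OF T(2,1,3)] .
    note \<rho> = dist_arr(2)[OF T(2)]
    obtain e where e: "arr R X e" "e \<cdot> \<rho> = q"
      using heart_reflection_factor[OF rr X dist_arr(1)[OF Q(2)]] .
    \<comment> \<open>The cone condition on \<open>q\<close> carries over to \<open>e\<close>, since
      a map that vanishes after \<open>e\<close> vanishes after \<open>q\<close>.\<close>
    have "epi_in D (heart t) R X e"
      unfolding epi_in_heart_iff
    proof (intro conjI ballI allI impI T(3) X e(1))
      fix Z z assume Z: "Z \<in> heart t" and z: "arr X Z z" and "z \<cdot> e = zr R Z"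
      then have "z \<cdot> q = zr Q Z"
        using assoc[OF \<rho> e(1) z] e(2) zero_left[OF \<rho> heart_Ob[OF Z]] by simp
      then show "z = zr X Z" using cone_le_minus1D[OF Q(2,3) Z z] by blast
    qed
    then show "\<exists>P e. projective_in D (heart t) P \<and> epi_in D (heart t) P X e"
      using dproj_reflection_projective[OF Q(1) rr] by blast
  qed
  moreover have "has_derived_projectives D t"
    unfolding has_derived_projectives_def
  proof (intro allI impI)
    fix P assume P: "projective_in D (heart t) P"
    then have "P \<in> Le0 t" by (simp add: projective_in_def heart_def)
    then show "\<exists>Q\<in>DProj D t. isomorphic D (H0 D t Q) P"
      using approx krull_schmidt_projective_lift[OF assms P] by blast
  qed
  ultimately show "has_enough_derived_projectives D t"
    unfolding has_enough_derived_projectives_def by blast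
qed

end

theorem theorem3p7:
  fixes K :: "('k, 'e) ring_scheme"
    and D :: "('k, 'o, 'm, 'z) tri_cat_scheme"
    and t :: "'o t_str"
  assumes "triangulated_category K D"
    and "krull_schmidt D"
    and "t_structure D t"
  shows "has_enough_derived_projectives D t \<longleftrightarrow>
    contravariantly_finite D (DProj D t) (Le0 t) \<and>
    right_perp D (DProj D t) \<inter> heart t = {X. zero_object D X}"
proof -
  interpret t_category K D t
    using assms by (simp add: t_category_def t_category_axioms_def)
  show ?thesis by (rule enough_derived_projectives_iff[OF assms(2)])
qed

end
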